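(* Suppose $v$ is a valuation on $\mathcal{A}_1(\mathbb{R})$ with residue field $\mathbb{R}$ and value group $\Gamma$. Then: (1) If $\Gamma$ is a $2$-divisible subgroup of $\mathbb{Q}$, there is a unique $v$-compatible ordering on $\mathcal{A}_1(\mathbb{R})$. (2) If $\Gamma$ is a non-$2$-divisible subgroup of $\mathbb{Q}$, there are exactly two $v$-compatible orderings on $\mathcal{A}_1(\mathbb{R})$. (3) If $\Gamma$ is a direct sum of a non-$2$-divisible subgroup of $\mathbb{Q}$ with $\mathbb{Z}$, there are exactly four $v$-compatible orderings on $\mathcal{A}_1(\mathbb{R})$.
   Context: A valuation on a division ring $D$ is a map $v:D\to\Gamma\cup\{\infty\}$, with $\Gamma$ an additively written totally ordered group and $\infty>\gamma$ for all $\gamma\in\Gamma$, such that $v(a)=\infty\iff a=0$, $v(ab)=v(a)+v(b)$ and $v(a+b)\ge\min\{v(a),v(b)\}$; the value group is $v(D\setminus\{0\})$. Valuations are trivial on $\mathbb{R}$, and "residue field $\mathbb{R}$" means that the natural map from $\mathbb{R}$ to the residue division ring $\{v\ge0\}/\{v>0\}$ is an isomorphism. $\mathcal{A}_1(\mathbb{R})$ is the $\mathbb{R}$-algebra generated by $x,y$ with $yx-xy=1$; it is an Ore domain with quotient division ring $\mathcal{D}_1(\mathbb{R})$. Valuations and orderings on $\mathcal{A}_1(\mathbb{R})$ extend uniquely to $\mathcal{D}_1(\mathbb{R})$ and are identified with these extensions. An ordering on a division ring $D$ is a subset $P\subseteq D$ with $P+P\subseteq P$, $PP\subseteq P$, $P\cup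 -P=D$, $P\cap -P=\{0\}$. It is compatible with $v$ if $ab\in P$ for all $a,b\in D\setminus\{0\}$ with $v(a)=v(b)<v(a-b)$. A subgroup $\Gamma$ is $2$-divisible if $2\Gamma=\Gamma$. *)

theory Defs
  imports
    "HOL-Analysis.Analysis"
    "HOL-Computational_Algebra.Polynomial"
    "HOL-Algebra.QuotRing"
begin

section \<open>The Weyl algebra\<close>

text \<open>
  The real algebra presented by two generators and the single relation \<open>y x - x y = 1\<close>, as the
  quotient of the algebra terms in \<open>x\<close>, \<open>y\<close> by the least congruence that contains the relation and
  the axioms of unital associative real algebras. Scalar multiplication by \<open>r\<close> is multiplication by
  the term \<open>WConst r\<close>.
\<close>

datatype weyl_term =
    WX | WY | WConst real | WAdd weyl_term weyl_term | WMult weyl_term weyl_term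

inductive weyl_eq :: "weyl_term \<Rightarrow> weyl_term \<Rightarrow> bool" where
  refl: "weyl_eq a a"
| sym: "weyl_eq a b \<Longrightarrow> weyl_eq b a"
| trans: "weyl_eq a b \<Longrightarrow> weyl_eq b c \<Longrightarrow> weyl_eq a c"
| add_cong: "weyl_eq a a' \<Longrightarrow> weyl_eq b b' \<Longrightarrow> weyl_eq (WAdd a b) (WAdd a' b')"
| mult_cong: "weyl_eq a a' \<Longrightarrow> weyl_eq b b' \<Longrightarrow> weyl_eq (WMult a b) (WMult a' b')"
| add_assoc: "weyl_eq (WAdd (WAdd a b) c) (WAdd a (WAdd b c))"
| add_commute: "weyl_eq (WAdd a b) (WAdd b a)"
| add_zero: "weyl_eq (WAdd (WConst 0) a) a"
| add_minus: "weyl_eq (WAdd (WMult (WConst (-1)) a) a) (WConst 0)"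
| mult_assoc: "weyl_eq (WMult (WMult a b) c) (WMult a (WMult b c))"
| mult_one_left: "weyl_eq (WMult (WConst 1) a) a"
| mult_one_right: "weyl_eq (WMult a (WConst 1)) a"
| distrib_left: "weyl_eq (WMult a (WAdd b c)) (WAdd (WMult a b) (WMult a c))"
| distrib_right: "weyl_eq (WMult (WAdd a b) c) (WAdd (WMult a c) (WMult b c))"
| const_add: "weyl_eq (WAdd (WConst r) (WConst s)) (WConst (r + s))"
| const_mult: "weyl_eq (WMult (WConst r) (WConst s)) (WConst (r * s))"
| const_central: "weyl_eq (WMult (WConst r) a) (WMult a (WConst r))"
| weyl_relation: "weyl_eq (WMult WY WX) (WAdd (WMult WX WY) (WConst 1))"

text \<open>
  The action on real polynomials by multiplication and differentiation; it is used only to see that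
  the presented algebra is not the zero ring.
\<close>

primrec weyl_act :: "weyl_term \<Rightarrow> real poly \<Rightarrow> real poly" where
  "weyl_act WX p = [:0, 1:] * p"
| "weyl_act WY p = pderiv p"
| "weyl_act (WConst r) p = smult r p"
| "weyl_act (WAdd a b) p = weyl_act a p + weyl_act b p"
| "weyl_act (WMult a b) p = weyl_act a (weyl_act b p)"

lemma weyl_act_add: "weyl_act a (p + q) = weyl_act a p + weyl_act a q"
  by (induction a arbitrary: p q) (simp_all add: algebra_simps pderiv_add smult_add_right)

lemma weyl_act_smult: "weyl_act a (smult r p) = smult r (weyl_act a p)"
  by (induction a arbitrary: p) (simp_all add: pderiv_smult smult_add_right mult.commute)

lemma weyl_eq_act: "weyl_eq a b \<Longrightarrow> weyl_act a = weyl_act b"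
  by (induction rule: weyl_eq.induct)
    (auto simp: fun_eq_iff weyl_act_add weyl_act_smult smult_add_left pderiv_mult pderiv_pCons
      algebra_simps)

quotient_type weyl = weyl_term / weyl_eq
  by (rule equivpI) (auto intro!: reflpI sympI transpI intro: weyl_eq.intros)

instantiation weyl :: real_algebra_1
begin

lift_definition zero_weyl :: weyl is "WConst 0" .

lift_definition one_weyl :: weyl is "WConst 1" .

lift_definition plus_weyl :: "weyl \<Rightarrow> weyl \<Rightarrow> weyl" is WAdd
  by (rule weyl_eq.add_cong)

lift_definition times_weyl :: "weyl \<Rightarrow> weyl \<Rightarrow> weyl" is WMult
  by (rule weyl_eq.mult_cong)

lift_definition uminus_weyl :: "weyl \<Rightarrow> weyl" is "WMult (WConst (-1))"
  by (rule weyl_eq.mult_cong[OF weyl_eq.refl])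

lift_definition minus_weyl :: "weyl \<Rightarrow> weyl \<Rightarrow> weyl" is "\<lambda>a b. WAdd a (WMult (WConst (-1)) b)"
  by (intro weyl_eq.add_cong weyl_eq.mult_cong weyl_eq.refl)

lift_definition scaleR_weyl :: "real \<Rightarrow> weyl \<Rightarrow> weyl" is "\<lambda>r. WMult (WConst r)"
  by (rule weyl_eq.mult_cong[OF weyl_eq.refl])

instance
proof
  fix a b c :: weyl and r s :: real
  show "a + b + c = a + (b + c)" by transfer (rule weyl_eq.add_assoc)
  show "a + b = b + a" by transfer (rule weyl_eq.add_commute)
  show "0 + a = a" by transfer (rule weyl_eq.add_zero)
  show "- a + a = 0" by transfer (rule weyl_eq.add_minus)
  show "a - b = a + - b" by transfer (rule weyl_eq.refl)
  show "a * b * c = a * (b * c)" by transfer (rule weyl_eq.mult_assoc)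
  show "1 * a = a" by transfer (rule weyl_eq.mult_one_left)
  show "a * 1 = a" by transfer (rule weyl_eq.mult_one_right)
  show "(a + b) * c = a * c + b * c" by transfer (rule weyl_eq.distrib_right)
  show "a * (b + c) = a * b + a * c" by transfer (rule weyl_eq.distrib_left)
  show "(0 :: weyl) \<noteq> 1"
  proof (transfer, rule notI)
    assume "weyl_eq (WConst 0) (WConst 1)"
    from fun_cong[OF weyl_eq_act[OF this], of 1] show False by simp
  qed
  show "r *\<^sub>R (a + b) = r *\<^sub>R a + r *\<^sub>R b" by transfer (rule weyl_eq.distrib_left)
  show "(r + s) *\<^sub>R a = r *\<^sub>R a + s *\<^sub>R a"
    by transfer
      (meson weyl_eq.trans weyl_eq.sym weyl_eq.refl weyl_eq.mult_cong weyl_eq.const_add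
        weyl_eq.distrib_right)
  show "r *\<^sub>R s *\<^sub>R a = (r * s) *\<^sub>R a"
    by transfer
      (meson weyl_eq.trans weyl_eq.sym weyl_eq.refl weyl_eq.mult_cong weyl_eq.const_mult
        weyl_eq.mult_assoc)
  show "1 *\<^sub>R a = a" by transfer (rule weyl_eq.mult_one_left)
  show "r *\<^sub>R a * b = r *\<^sub>R (a * b)" by transfer (rule weyl_eq.mult_assoc)
  show "a * r *\<^sub>R b = r *\<^sub>R (a * b)"
    by transfer
      (meson weyl_eq.trans weyl_eq.sym weyl_eq.refl weyl_eq.mult_cong weyl_eq.const_central
        weyl_eq.mult_assoc)
qed

end

lift_definition weyl_x :: weyl is WX .

lift_definition weyl_y :: weyl is WY .

lemma weyl_commutator: "weyl_y * weyl_x - weyl_x * weyl_y = 1"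
proof -
  have "weyl_y * weyl_x = weyl_x * weyl_y + 1" by transfer (rule weyl_eq.weyl_relation)
  then show ?thesis by simp
qed


section \<open>Quotient division rings\<close>

text \<open>
  \<open>quotient_division_ring \<iota>\<close>: the target of \<open>\<iota>\<close> is a quotient division ring of its source, the latter
  being embedded via \<open>\<iota>\<close>. For an Ore domain this determines the division ring up to a unique
  isomorphism over the domain.
\<close>

definition quotient_division_ring :: "('a::real_algebra_1 \<Rightarrow> 'd::real_div_algebra) \<Rightarrow> bool" where
  "quotient_division_ring \<iota> \<longleftrightarrow>
     (\<forall>a b. \<iota> (a + b) = \<iota> a + \<iota> b) \<and> (\<forall>a b. \<iota> (a * b) = \<iota> a * \<iota> b) \<and> \<iota> 1 = 1 \<and>
     (\<forall>r a. \<iota> (r *\<^sub>R a) = r *\<^sub>R \<iota> a) \<and> inj \<iota> \<and>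
     (\<forall>d. \<exists>a b. b \<noteq> 0 \<and> d = \<iota> a * inverse (\<iota> b))"


section \<open>Valuations\<close>

text \<open>Totally ordered groups in additive notation, not assumed to be abelian.\<close>

class totally_ordered_group = group_add + linorder +
  assumes left_mono: "a \<le> b \<Longrightarrow> c + a \<le> c + b"
    and right_mono: "a \<le> b \<Longrightarrow> a + c \<le> b + c"

datatype 'g with_infty = Fin 'g | Infty

instantiation with_infty :: (linorder) linorder
begin

fun less_eq_with_infty :: "'a with_infty \<Rightarrow> 'a with_infty \<Rightarrow> bool" where
  "Fin a \<le> Fin b \<longleftrightarrow> a \<le> b"
| "_ \<le> Infty \<longleftrightarrow> True"
| "Infty \<le> Fin b \<longleftrightarrow> False"

definition less_with_infty :: "'a with_infty \<Rightarrow> 'a with_infty \<Rightarrow> bool" where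
  "x < y \<longleftrightarrow> x \<le> y \<and> \<not> y \<le> (x :: 'a with_infty)"

instance
proof
  fix x y z :: "'a with_infty"
  show "(x < y) = (x \<le> y \<and> \<not> y \<le> x)" by (rule less_with_infty_def)
  show "x \<le> x" by (cases x) auto
  show "x \<le> y \<Longrightarrow> y \<le> z \<Longrightarrow> x \<le> z" by (cases x; cases y; cases z) auto
  show "x \<le> y \<Longrightarrow> y \<le> x \<Longrightarrow> x = y" by (cases x; cases y) auto
  show "x \<le> y \<or> y \<le> x" by (cases x; cases y) auto
qed

end

instantiation with_infty :: (plus) plus
begin

fun plus_with_infty :: "'a with_infty \<Rightarrow> 'a with_infty \<Rightarrow> 'a with_infty" where
  "Fin a + Fin b = Fin (a + b)"
| "Fin a + Infty = Infty"
| "Infty + _ = Infty"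

instance ..

end

text \<open>The last clause is triviality on the scalars.\<close>

definition valuation :: "('d::real_div_algebra \<Rightarrow> 'g::totally_ordered_group with_infty) \<Rightarrow> bool" where
  "valuation v \<longleftrightarrow>
     (\<forall>a. v a = Infty \<longleftrightarrow> a = 0) \<and> (\<forall>a b. v (a * b) = v a + v b) \<and>
     (\<forall>a b. v (a + b) \<ge> min (v a) (v b)) \<and> (\<forall>r. r \<noteq> 0 \<longrightarrow> v (of_real r) = Fin 0)"

definition value_group :: "('d::real_div_algebra \<Rightarrow> 'g::totally_ordered_group with_infty) \<Rightarrow> 'g set" where
  "value_group v = {g. \<exists>a. a \<noteq> 0 \<and> v a = Fin g}"

definition valuation_ring ::
    "('d::real_div_algebra \<Rightarrow> 'g::totally_ordered_group with_infty) \<Rightarrow> 'd ring" where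
  "valuation_ring v =
     \<lparr>carrier = {a. v a \<ge> Fin 0}, mult = (*), one = 1, zero = 0, add = (+)\<rparr>"

definition valuation_ideal ::
    "('d::real_div_algebra \<Rightarrow> 'g::totally_ordered_group with_infty) \<Rightarrow> 'd set" where
  "valuation_ideal v = {a. v a > Fin 0}"

definition real_ring :: "real ring" where
  "real_ring = \<lparr>carrier = UNIV, mult = (*), one = 1, zero = 0, add = (+)\<rparr>"

definition residue_field_real ::
    "('d::real_div_algebra \<Rightarrow> 'g::totally_ordered_group with_infty) \<Rightarrow> bool" where
  "residue_field_real v \<longleftrightarrow>
     (\<lambda>r. valuation_ideal v +>\<^bsub>valuation_ring v\<^esub> of_real r)
       \<in> ring_iso real_ring (valuation_ring v Quot valuation_ideal v)"


section \<open>Orderings\<close>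

definition division_ring_ordering :: "'d::division_ring set \<Rightarrow> bool" where
  "division_ring_ordering P \<longleftrightarrow>
     (\<forall>a\<in>P. \<forall>b\<in>P. a + b \<in> P) \<and> (\<forall>a\<in>P. \<forall>b\<in>P. a * b \<in> P) \<and>
     P \<union> uminus ` P = UNIV \<and> P \<inter> uminus ` P = {0}"

definition compatible_with ::
    "('d::real_div_algebra \<Rightarrow> 'g::totally_ordered_group with_infty) \<Rightarrow> 'd set \<Rightarrow> bool" where
  "compatible_with v P \<longleftrightarrow>
     (\<forall>a b. a \<noteq> 0 \<longrightarrow> b \<noteq> 0 \<longrightarrow> v a = v b \<longrightarrow> v b < v (a - b) \<longrightarrow> a * b \<in> P)"

definition compatible_orderings ::
    "('d::real_div_algebra \<Rightarrow> 'g::totally_ordered_group with_infty) \<Rightarrow> 'd set set" where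
  "compatible_orderings v = {P. division_ring_ordering P \<and> compatible_with v P}"


section \<open>Additive groups\<close>

definition additive_subgroup_of :: "'a::group_add set \<Rightarrow> bool" where
  "additive_subgroup_of H \<longleftrightarrow> 0 \<in> H \<and> (\<forall>a\<in>H. \<forall>b\<in>H. a + b \<in> H) \<and> (\<forall>a\<in>H. - a \<in> H)"

definition two_divisible :: "'a::plus set \<Rightarrow> bool" where
  "two_divisible H \<longleftrightarrow> (\<lambda>a. a + a) ` H = H"

text \<open>Isomorphism of abstract groups; orders play no role.\<close>

definition isomorphic_groups :: "'a::plus set \<Rightarrow> 'b::plus set \<Rightarrow> bool" where
  "isomorphic_groups G H \<longleftrightarrow>
     (\<exists>f. bij_betw f G H \<and> (\<forall>a\<in>G. \<forall>b\<in>G. f (a + b) = f a + f b))"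

end

theory Submission
  imports Defs
begin

text \<open>
  Since the residue field is \<open>\<real>\<close>, a compatible ordering is a character
  \<open>D\<^sup>\<times> \<rightarrow> {\<plusminus>1}\<close> with \<open>-1 \<mapsto> -1\<close> that is trivial on the units with positive residue. If all
  commutators \<open>a b a\<^sup>-\<^sup>1 b\<^sup>-\<^sup>1\<close> have positive residue, then the products of such units and squares
  form a subgroup \<open>N\<close> that does not contain \<open>-1\<close>, and \<open>D\<^sup>\<times>/\<plusminus>N = \<Gamma>/2\<Gamma>\<close>; so there are
  \<open>|\<Gamma>/2\<Gamma>|\<close> compatible orderings.

  The sign of the residue of a commutator is an alternating bilinear form on \<open>\<Gamma>/2\<Gamma>\<close>. If that
  group has at most four elements, it suffices to evaluate the form on one pair \<open>f, g\<close> of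
  generators. Choose \<open>f\<close> of minimal degree in \<open>y\<close> with value outside \<open>2\<Gamma>\<close>, and then \<open>g\<close> of minimal
  degree with value outside \<open>2\<Gamma> \<union> (v f + 2\<Gamma>)\<close>. If the sign were negative, \<open>h = f g - g f\<close> would
  have value \<open>v f + v g\<close>, while its degree is less than \<open>deg f + deg g\<close>. Dividing, \<open>h = q g + r\<close>
  with \<open>deg q < deg f\<close> and \<open>deg r < deg g\<close>, so the values of \<open>h\<close>, \<open>q g\<close>, \<open>r\<close> lie in distinct
  classes modulo \<open>2\<Gamma>\<close>, which is impossible.
\<close>


section \<open>Filtration by degree in \<open>Y\<close>\<close>

locale weyl_pair =
  fixes X Y :: "'d::real_div_algebra"
  assumes weyl_relation: "Y * X - X * Y = 1"
begin

section \<open>A commutative domain of coefficients inside the division ring\<close>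

definition commutant :: "'d set \<Rightarrow> 'd set" where
  "commutant A = {a. \<forall>x\<in>A. a * x = x * a}"

text \<open>
  A substitute for \<open>\<real>(X)\<close>: the double commutant of \<open>X\<close> is visibly a commutative division subring
  that is stable under \<open>[Y, -]\<close>.
\<close>

definition F :: "'d set" where
  "F = commutant (commutant {X})"

text \<open>By the Jacobi identity \<open>[[Y, c], X] = [Y, [c, X]] - [c, [Y, X]]\<close>, where
  \<open>[c, X] = 0\<close> and \<open>[Y, X] = 1\<close> is central.\<close>

lemma derivation_commutant:
  assumes "c \<in> commutant {X}"
  shows "Y * c - c * Y \<in> commutant {X}"
proof -
  have c: "c * X = X * c" using assms by (simp add: commutant_def)
  have YX: "Y * X = X * Y + 1" using weyl_relation by (simp add: algebra_simps)
  have 1: "Y * (X * z) = X * (Y * z) + z" for z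
    unfolding mult.assoc[symmetric] YX by (simp add: algebra_simps)
  have 2: "c * (X * z) = X * (c * z)" for z
    unfolding mult.assoc[symmetric] c ..
  have "(Y * c - c * Y) * X = X * (Y * c - c * Y)"
    using c YX 1 2 by (simp add: algebra_simps)
  then show ?thesis by (simp add: commutant_def)
qed

lemma F_commute: "a \<in> F \<Longrightarrow> c \<in> commutant {X} \<Longrightarrow> a * c = c * a"
  by (simp add: F_def commutant_def)

lemma F_subset: "F \<subseteq> commutant {X}"
  by (auto simp: F_def commutant_def)

text \<open>Jacobi again: \<open>[[Y, a], c] = [Y, [a, c]] - [a, [Y, c]]\<close>, and
  \<open>[Y, c]\<close> stays in the commutant of \<open>X\<close>, so \<open>a\<close> commutes
  with it too.\<close>

lemma F_derivation:
  assumes "a \<in> F"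
  shows "Y * a - a * Y \<in> F"
proof -
  have "(Y * a - a * Y) * c = c * (Y * a - a * Y)" if c: "c \<in> commutant {X}" for c
  proof -
    have 1: "a * c = c * a" and 2: "a * (Y * c - c * Y) = (Y * c - c * Y) * a"
      using F_commute assms c derivation_commutant by auto
    have "(Y * a - a * Y) * c = Y * (a * c) - a * (Y * c - c * Y) - (a * c) * Y"
      by (simp add: algebra_simps)
    also have "\<dots> = Y * (c * a) - (Y * c - c * Y) * a - (c * a) * Y" unfolding 1 2 ..
    also have "\<dots> = c * (Y * a - a * Y)" by (simp add: algebra_simps)
    finally show ?thesis .
  qed
  then show ?thesis by (simp add: F_def commutant_def[of "commutant {X}"])
qed

lemma F_comm: "a \<in> F \<Longrightarrow> b \<in> F \<Longrightarrow> a * b = b * a"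
  using F_commute F_subset by blast

lemma F_iff: "a \<in> F \<longleftrightarrow> (\<forall>c. c * X = X * c \<longrightarrow> a * c = c * a)"
  by (auto simp: F_def commutant_def)

lemma F_0: "0 \<in> F" and F_1: "1 \<in> F" and F_X: "X \<in> F"
  by (simp_all add: F_iff)

lemma F_of_real: "of_real r \<in> F"
  by (simp add: F_iff of_real_def)

lemma F_add: "a \<in> F \<Longrightarrow> b \<in> F \<Longrightarrow> a + b \<in> F"
  by (simp add: F_iff algebra_simps)

lemma F_minus: "a \<in> F \<Longrightarrow> - a \<in> F"
  by (simp add: F_iff)

lemma F_mult: "a \<in> F \<Longrightarrow> b \<in> F \<Longrightarrow> a * b \<in> F"
  unfolding F_iff by (metis mult.assoc)

lemma F_inverse: assumes "a \<in> F" shows "inverse a \<in> F"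
proof (cases "a = 0")
  case False
  have "inverse a * c = c * inverse a" if "c \<in> commutant {X}" for c
  proof -
    have "a * c = c * a" using F_commute assms that by blast
    then have "inverse a * (a * c) * inverse a = inverse a * (c * a) * inverse a" by simp
    moreover have "inverse a * (a * c) * inverse a = c * inverse a"
      using False by (simp add: mult.assoc[symmetric])
    moreover have "inverse a * (c * a) * inverse a = inverse a * c"
      using False by (simp add: mult.assoc)
    ultimately show ?thesis by simp
  qed
  then show ?thesis by (simp add: F_def commutant_def[of "commutant {X}"])
qed (simp add: F_0)

text \<open>Polynomials in \<open>Y\<close> with coefficients on the left, indexed by a strict
  degree bound: \<open>V (Suc n)\<close> stands for degree at most \<open>n\<close>, and
  \<open>V 0\<close> holds only the zero polynomial.\<close>

primrec V :: "nat \<Rightarrow> 'd set" where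
  "V 0 = {0}"
| "V (Suc k) = {a * Y ^ k + w | a w. a \<in> F \<and> w \<in> V k}"

lemma V_SucI: "a \<in> F \<Longrightarrow> w \<in> V k \<Longrightarrow> a * Y ^ k + w \<in> V (Suc k)"
  by auto

lemma V_SucE:
  assumes "u \<in> V (Suc k)"
  obtains a w where "a \<in> F" "w \<in> V k" "u = a * Y ^ k + w"
  using assms by auto

declare V.simps(2) [simp del]

lemma V_0: "0 \<in> V k"
proof (induction k)
  case (Suc k)
  then show ?case using V_SucI[OF F_0] by force
qed simp

lemma V_Suc: "u \<in> V k \<Longrightarrow> u \<in> V (Suc k)"
  using V_SucI[OF F_0] by force

lemma V_mono: "j \<le> k \<Longrightarrow> V j \<subseteq> V k"
  using lift_Suc_mono_le[of V] V_Suc by blast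

lemma V_monomial: "a \<in> F \<Longrightarrow> a * Y ^ k \<in> V (Suc k)"
  using V_SucI[OF _ V_0] by force

lemma V_add: "u \<in> V k \<Longrightarrow> w \<in> V k \<Longrightarrow> u + w \<in> V k"
proof (induction k arbitrary: u w)
  case (Suc k)
  obtain a u' where u: "a \<in> F" "u' \<in> V k" "u = a * Y ^ k + u'" using Suc.prems(1) by (rule V_SucE)
  obtain b w' where w: "b \<in> F" "w' \<in> V k" "w = b * Y ^ k + w'" using Suc.prems(2) by (rule V_SucE)
  have "u + w = (a + b) * Y ^ k + (u' + w')" by (simp add: u(3) w(3) algebra_simps)
  then show ?case using V_SucI[OF F_add[OF u(1) w(1)] Suc.IH[OF u(2) w(2)]] by simp
qed simp

lemma V_F_mult: "c \<in> F \<Longrightarrow> u \<in> V k \<Longrightarrow> c * u \<in> V k"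
proof (induction k arbitrary: u)
  case (Suc k)
  obtain a u' where u: "a \<in> F" "u' \<in> V k" "u = a * Y ^ k + u'" using Suc.prems(2) by (rule V_SucE)
  have "c * u = (c * a) * Y ^ k + c * u'" by (simp add: u(3) algebra_simps)
  then show ?case using V_SucI[OF F_mult[OF Suc.prems(1) u(1)] Suc.IH[OF Suc.prems(1) u(2)]] by simp
qed simp

lemma V_minus: "u \<in> V k \<Longrightarrow> - u \<in> V k"
  using V_F_mult[OF F_minus[OF F_1]] by force

lemma V_diff: "u \<in> V k \<Longrightarrow> w \<in> V k \<Longrightarrow> u - w \<in> V k"
  using V_add[OF _ V_minus] by force

section \<open>Products, commutators and division in the filtration\<close>

lemma V_mult_Y: "u \<in> V k \<Longrightarrow> u * Y \<in> V (Suc k)"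
proof (induction k arbitrary: u)
  case (Suc k)
  obtain a u' where u: "a \<in> F" "u' \<in> V k" "u = a * Y ^ k + u'" using Suc.prems by (rule V_SucE)
  have "u * Y = a * Y ^ Suc k + u' * Y"
    unfolding u(3) by (simp add: algebra_simps power_commutes)
  then show ?case using V_SucI[OF u(1) Suc.IH[OF u(2)]] by simp
qed (simp add: V_0)

lemma V_mult_Y_power: "u \<in> V k \<Longrightarrow> u * Y ^ j \<in> V (k + j)"
proof (induction j)
  case (Suc j)
  then show ?case using V_mult_Y[of "u * Y ^ j" "k + j"] by (simp add: mult.assoc power_commutes)
qed simp

text \<open>\<open>Y\<close> commutes with its powers, so \<open>[Y, -]\<close> acts on the
  coefficients alone.\<close>

lemma V_commutator_Y: "u \<in> V k \<Longrightarrow> Y * u - u * Y \<in> V k"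
proof (induction k arbitrary: u)
  case (Suc k)
  obtain a u' where u: "a \<in> F" "u' \<in> V k" "u = a * Y ^ k + u'" using Suc.prems by (rule V_SucE)
  have "Y * u - u * Y = (Y * a - a * Y) * Y ^ k + (Y * u' - u' * Y)"
    unfolding u(3) by (simp add: algebra_simps power_commutes)
  then show ?case using V_SucI[OF F_derivation[OF u(1)] Suc.IH[OF u(2)]] by simp
qed simp

lemma V_Y_mult: "u \<in> V k \<Longrightarrow> Y * u \<in> V (Suc k)"
  using V_add[OF V_Suc[OF V_commutator_Y] V_mult_Y] by force

lemma V_Y_power_mult: "u \<in> V k \<Longrightarrow> Y ^ j * u \<in> V (k + j)"
proof (induction j)
  case (Suc j)
  then show ?case using V_Y_mult[of "Y ^ j * u" "k + j"] by (simp add: mult.assoc)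
qed simp

lemma V_mult: "u \<in> V k \<Longrightarrow> w \<in> V j \<Longrightarrow> u * w \<in> V (k + j)"
proof (induction k arbitrary: u)
  case 0
  then show ?case by (simp add: V_0)
next
  case (Suc k)
  obtain a u' where u: "a \<in> F" "u' \<in> V k" "u = a * Y ^ k + u'" using Suc.prems(1) by (rule V_SucE)
  have "a * (Y ^ k * w) + u' * w \<in> V (k + j)"
    using V_add[OF V_F_mult[OF u(1) V_Y_power_mult[OF Suc.prems(2), of k]]] Suc.IH[OF u(2) Suc.prems(2)]
    by (simp add: add.commute)
  then show ?case using V_Suc by (simp add: u(3) algebra_simps)
qed

text \<open>Leibniz rule: \<open>[Y * Y ^ k, a] = Y * [Y ^ k, a] + [Y, a] * Y ^ k\<close>.\<close>

lemma Y_power_commutator_F: "a \<in> F \<Longrightarrow> Y ^ k * a - a * Y ^ k \<in> V k"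
proof (induction k)
  case (Suc k)
  have "Y ^ Suc k * a - a * Y ^ Suc k = Y * (Y ^ k * a - a * Y ^ k) + (Y * a - a * Y) * Y ^ k"
    by (simp add: algebra_simps)
  then show ?case
    using V_add[OF V_Y_mult[OF Suc.IH[OF Suc.prems]] V_monomial[OF F_derivation[OF Suc.prems]]] by simp
qed simp

text \<open>Coefficients commute with each other, so the leading terms of \<open>u * a\<close> and
  \<open>a * u\<close> cancel.\<close>

lemma V_commutator_F: "u \<in> V (Suc k) \<Longrightarrow> a \<in> F \<Longrightarrow> u * a - a * u \<in> V k"
proof (induction k arbitrary: u)
  case 0
  then show ?case using F_comm by (auto simp: V.simps(2))
next
  case (Suc k)
  obtain b w where u: "b \<in> F" "w \<in> V (Suc k)" "u = b * Y ^ Suc k + w" using Suc.prems(1) by (rule V_SucE)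
  have ab: "a * b = b * a" using F_comm Suc.prems u(1) by blast
  have "u * a - a * u = b * (Y ^ Suc k * a) - a * b * Y ^ Suc k + (w * a - a * w)"
    unfolding u(3) by (simp add: algebra_simps)
  also have "\<dots> = b * (Y ^ Suc k * a - a * Y ^ Suc k) + (w * a - a * w)"
    unfolding ab by (simp add: algebra_simps)
  finally show ?case
    using V_add[OF V_F_mult[OF u(1) Y_power_commutator_F[OF Suc.prems(2)]]
        V_Suc[OF Suc.IH[OF u(2) Suc.prems(2)]]] by (simp)
qed

text \<open>Leibniz rule in the other factor:
  \<open>[u, Y ^ m * Y] = [u, Y ^ m] * Y + Y ^ m * [u, Y]\<close>.\<close>

lemma V_commutator_Y_power: "u \<in> V (Suc n) \<Longrightarrow> u * Y ^ m - Y ^ m * u \<in> V (n + m)"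
proof (induction m)
  case 0
  then show ?case by (simp add: V_0)
next
  case (Suc m)
  have "u * Y - Y * u \<in> V (Suc n)"
    using V_minus[OF V_commutator_Y[OF Suc.prems]] by simp
  from V_Y_power_mult[OF this, of m] V_mult_Y[OF Suc.IH[OF Suc.prems]]
  have "(u * Y ^ m - Y ^ m * u) * Y + Y ^ m * (u * Y - Y * u) \<in> V (n + Suc m)"
    using V_add by (simp)
  moreover have "Y ^ m * (Y * u) = Y ^ Suc m * u"
    by (simp add: power_commutes[symmetric] mult.assoc)
  ultimately show ?case by (simp add: algebra_simps power_commutes)
qed

text \<open>The associated graded ring is commutative: \<open>u * w\<close> has degree at most
  \<open>n + m\<close>, and the commutator loses one degree. This loss makes the quotient in
  \<open>posunit_K\<close> smaller than \<open>f\<close>.\<close>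

lemma V_commutator:
  "u \<in> V (Suc n) \<Longrightarrow> w \<in> V (Suc m) \<Longrightarrow> u * w - w * u \<in> V (n + m)"
proof (induction m arbitrary: w)
  case 0
  then show ?case using V_commutator_F[of u n] by (auto simp: V.simps(2))
next
  case (Suc m)
  obtain b w' where w: "b \<in> F" "w' \<in> V (Suc m)" "w = b * Y ^ Suc m + w'" using Suc.prems(2) by (rule V_SucE)
  have "u * w - w * u = (u * b - b * u) * Y ^ Suc m + b * (u * Y ^ Suc m - Y ^ Suc m * u)
      + (u * w' - w' * u)"
    unfolding w(3) by (simp add: algebra_simps)
  then show ?case
    using V_add[OF V_add[OF V_mult_Y_power[OF V_commutator_F[OF Suc.prems(1) w(1)], of "Suc m"]
      V_F_mult[OF w(1) V_commutator_Y_power[OF Suc.prems(1), of "Suc m"]]]]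
      V_Suc[OF Suc.IH[OF Suc.prems(1) w(2)]] by (simp)
qed

text \<open>Euclidean division with the quotient on the left; the leading coefficient of
  \<open>g\<close> is nonzero, hence invertible in \<open>F\<close>. For \<open>k \<le> m\<close>
  the truncated difference forces \<open>q = 0\<close>.\<close>

lemma V_division:
  assumes g: "g \<in> V (Suc m)" "g \<notin> V m"
  shows "h \<in> V k \<Longrightarrow> \<exists>q r. q \<in> V (k - m) \<and> r \<in> V m \<and> h = q * g + r"
proof (induction k arbitrary: h)
  case 0
  then show ?case using V_0 by (intro exI[of _ 0]) auto
next
  case (Suc j)
  show ?case
  proof (cases "j < m")
    case True
    then have "h \<in> V m" using V_mono[of "Suc j" m] Suc.prems by auto
    then show ?thesis using V_0 by (intro exI[of _ 0] exI[of _ h]) auto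
  next
    case False
    define i where "i = j - m"
    have j: "j = m + i" using False by (simp add: i_def)
    obtain a w where h: "a \<in> F" "w \<in> V j" "h = a * Y ^ j + w" using Suc.prems by (rule V_SucE)
    obtain b w' where b: "b \<in> F" "w' \<in> V m" "g = b * Y ^ m + w'" using g(1) by (rule V_SucE)
    have "b \<noteq> 0" using b g(2) by auto
    \<comment> \<open>With this coefficient \<open>c * Y ^ i * g\<close> has the leading term of
      \<open>h\<close>, so subtracting it lowers the degree bound to \<open>j\<close>.\<close>
    define c where "c = a * inverse b"
    have c: "c \<in> F" using h(1) b(1) F_mult F_inverse by (simp add: c_def)
    have a: "a = c * b" using \<open>b \<noteq> 0\<close> by (simp add: c_def mult.assoc)
    have "Y ^ j = Y ^ i * Y ^ m" by (simp add: j power_add[symmetric] add.commute)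
    then have "h - c * Y ^ i * g = w - c * ((Y ^ i * b - b * Y ^ i) * Y ^ m + Y ^ i * w')"
      unfolding h(3) b(3) a by (simp add: algebra_simps)
    moreover have "(Y ^ i * b - b * Y ^ i) * Y ^ m \<in> V j" "Y ^ i * w' \<in> V j"
      using V_mult_Y_power[OF Y_power_commutator_F[OF b(1)]] V_Y_power_mult[OF b(2)]
      by (auto simp: j add.commute)
    ultimately have "h - c * Y ^ i * g \<in> V j"
      using V_diff[OF h(2) V_F_mult[OF c V_add]] by auto
    from Suc.IH[OF this] obtain q r where
      qr: "q \<in> V (j - m)" "r \<in> V m" "h - c * Y ^ i * g = q * g + r" by blast
    have "h = (c * Y ^ i + q) * g + r" using qr(3) by (simp add: algebra_simps)
    moreover have "c * Y ^ i + q \<in> V (Suc j - m)"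
      using V_SucI[OF c] qr(1) by (auto simp: j i_def[symmetric] Suc_diff_le)
    ultimately show ?thesis using qr(2) by blast
  qed
qed

end


section \<open>Values and residues\<close>

context totally_ordered_group
begin

lemma left_strict_mono: "a < b \<Longrightarrow> c + a < c + b"
  using left_mono[of a b c] by (auto simp: less_le)

lemma right_strict_mono: "a < b \<Longrightarrow> a + c < b + c"
  using right_mono[of a b c] by (auto simp: less_le)

lemma add_strict_mono': "a < b \<Longrightarrow> c < d \<Longrightarrow> a + c < b + d"
  using left_strict_mono[of c d b] right_strict_mono[of a b c] by (blast intro: less_trans)

text \<open>The group may be non-abelian; this makes positive values stable under conjugation in
  \<open>M_conj\<close>.\<close>

lemma conj_pos: "0 < b \<Longrightarrow> 0 < a + b + - a"
  using right_strict_mono[OF left_strict_mono[of 0 b a], of "- a"] by simp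

text \<open>Doubling preserves the sign of an element, so there is no 2-torsion.\<close>

lemma double_eq_0_iff: "a + a = 0 \<longleftrightarrow> a = 0"
  using add_strict_mono'[of a 0 a 0] add_strict_mono'[of 0 a 0 a] by (cases a "0" rule: linorder_cases) auto

end

locale real_residue_valuation =
  fixes v :: "'d::real_div_algebra \<Rightarrow> 'g::totally_ordered_group with_infty"
  assumes valuation: "valuation v" and residue: "residue_field_real v"
begin

text \<open>Unspecified at \<open>0\<close>.\<close>

definition w :: "'d \<Rightarrow> 'g" where
  "w a = (THE g. v a = Fin g)"

lemma v_w: "a \<noteq> 0 \<Longrightarrow> v a = Fin (w a)"
  using valuation unfolding w_def valuation_def by (cases "v a") auto

lemma v_0: "v 0 = Infty"
  using valuation unfolding valuation_def by blast

lemma w_mult: "a \<noteq> 0 \<Longrightarrow> b \<noteq> 0 \<Longrightarrow> w (a * b) = w a + w b"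
  using valuation v_w[of a] v_w[of b] v_w[of "a * b"] unfolding valuation_def by simp

lemma w_add: "a \<noteq> 0 \<Longrightarrow> b \<noteq> 0 \<Longrightarrow> a + b \<noteq> 0 \<Longrightarrow> min (w a) (w b) \<le> w (a + b)"
proof -
  assume *: "a \<noteq> 0" "b \<noteq> 0" "a + b \<noteq> 0"
  then have "min (v a) (v b) \<le> v (a + b)" using valuation unfolding valuation_def by blast
  then show ?thesis using * by (auto simp: v_w min_def split: if_splits)
qed

lemma w_of_real: "r \<noteq> 0 \<Longrightarrow> w (of_real r) = 0"
  using valuation v_w[of "of_real r"] unfolding valuation_def by simp

lemma w_1: "w 1 = 0"
  using w_of_real[of 1] by simp

lemma w_minus: "w (- a) = w a"
proof (cases "a = 0")
  case False
  then show ?thesis using w_mult[of "of_real (-1)" a] w_of_real[of "-1"] by simp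
qed simp

lemma w_inverse: "a \<noteq> 0 \<Longrightarrow> w (inverse a) = - w a"
  using w_mult[of a "inverse a"] w_1 by (simp add: eq_neg_iff_add_eq_0 neg_eq_iff_add_eq_0[symmetric])

lemma w_add_less:
  assumes "a \<noteq> 0" "b \<noteq> 0" "w a < w b"
  shows "a + b \<noteq> 0 \<and> w (a + b) = w a"
proof -
  have ab: "a + b \<noteq> 0" using assms w_minus[of b] by (auto simp: add_eq_0_iff2)
  have "w a \<le> w (a + b)" using w_add[OF assms(1,2) ab] assms(3) by (simp add: min_def split: if_splits)
  \<comment> \<open>The reverse inequality comes from writing \<open>a\<close> as
    \<open>(a + b) + (- b)\<close>.\<close>
  moreover have "min (w (a + b)) (w b) \<le> w a"
    using w_add[of "a + b" "- b"] w_minus[of b] assms ab by simp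
  ultimately show ?thesis using ab assms(3) by (auto simp: min_def split: if_splits)
qed

lemma w_diff_cases:
  assumes "a \<noteq> 0" "b \<noteq> 0" "w a \<noteq> w b"
  shows "w (a - b) = w a \<or> w (a - b) = w b"
proof (cases "w a < w b")
  case True
  then show ?thesis using w_add_less[of a "- b"] assms w_minus[of b] by simp
next
  case False
  then have "w b < w a" using assms(3) by simp
  then show ?thesis using w_add_less[of "- b" a] assms w_minus[of b] by simp
qed

text \<open>Zero is listed separately because \<open>w 0\<close> is unspecified.\<close>

definition M :: "'d set" where
  "M = {a. a = 0 \<or> 0 < w a}"

lemma M_add: "a \<in> M \<Longrightarrow> b \<in> M \<Longrightarrow> a + b \<in> M"
  using w_add[of a b] by (cases "a = 0 \<or> b = 0") (auto simp: M_def intro: less_le_trans[of 0 "min (w a) (w b)"])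

lemma M_minus: "a \<in> M \<Longrightarrow> - a \<in> M"
  by (auto simp: M_def w_minus)

lemma M_mult_unit: "a \<in> M \<Longrightarrow> w u = 0 \<Longrightarrow> a * u \<in> M"
  by (cases "a = 0 \<or> u = 0") (auto simp: M_def w_mult)

lemma M_unit_mult: "a \<in> M \<Longrightarrow> w u = 0 \<Longrightarrow> u * a \<in> M"
  by (cases "a = 0 \<or> u = 0") (auto simp: M_def w_mult)

lemma M_conj: "a \<noteq> 0 \<Longrightarrow> b \<in> M \<Longrightarrow> a * b * inverse a \<in> M"
  using conj_pos[of "w b" "w a"] by (cases "b = 0") (auto simp: M_def w_mult w_inverse)

text \<open>Surjectivity of the map from the reals onto the residue ring, translated from cosets to
  representatives; \<open>r\<close> is nonzero because \<open>u\<close> is not in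
  \<open>M\<close>.\<close>

lemma residue_exists:
  assumes "u \<noteq> 0" "w u = 0"
  shows "\<exists>r. r \<noteq> 0 \<and> u - of_real r \<in> M"
proof -
  let ?I = "valuation_ideal v" and ?R = "valuation_ring v"
  have "u \<in> carrier ?R" using assms by (simp add: valuation_ring_def v_w)
  then have "?I +>\<^bsub>?R\<^esub> u \<in> carrier (?R Quot ?I)"
    by (auto simp: FactRing_def A_RCOSETS_def')
  then obtain r :: real where r: "?I +>\<^bsub>?R\<^esub> u = ?I +>\<^bsub>?R\<^esub> of_real r"
    using residue unfolding residue_field_real_def ring_iso_def bij_betw_def by auto
  have "u \<in> ?I +>\<^bsub>?R\<^esub> u"
    by (auto simp: a_r_coset_def' valuation_ideal_def valuation_ring_def v_0 less_le)
  then obtain i where i: "i \<in> ?I" "u = i + of_real r"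
    unfolding r by (auto simp: a_r_coset_def' valuation_ring_def)
  then have "u - of_real r \<in> M"
    by (auto simp: valuation_ideal_def M_def v_w less_le)
  moreover from this have "r \<noteq> 0" using assms by (auto simp: M_def)
  ultimately show ?thesis by blast
qed

text \<open>Units with positive real residue; like the nonzero squares, they are forced into every
  compatible ordering (\<open>ordering_precone\<close>).\<close>

definition posunit :: "'d \<Rightarrow> bool" where
  "posunit u \<longleftrightarrow> (\<exists>r>0. u - of_real r \<in> M)"

lemma posunit_unit:
  assumes "posunit u"
  shows "u \<noteq> 0" "w u = 0"
proof -
  obtain r where r: "r > 0" "u - of_real r \<in> M" using assms by (auto simp: posunit_def)
  have "u \<noteq> 0 \<and> w u = 0"
  proof (cases "u = of_real r")
    case True
    then show ?thesis using r w_of_real by simp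
  next
    case False
    then show ?thesis using w_add_less[of "of_real r" "u - of_real r"] r w_of_real[of r]
      by (auto simp: M_def)
  qed
  then show "u \<noteq> 0" "w u = 0" by auto
qed

lemma posunit_cases: "u \<noteq> 0 \<Longrightarrow> w u = 0 \<Longrightarrow> posunit u \<or> posunit (- u)"
proof -
  assume "u \<noteq> 0" "w u = 0"
  then obtain r where r: "r \<noteq> 0" "u - of_real r \<in> M" using residue_exists by blast
  then have "- u - of_real (- r) \<in> M" using M_minus by force
  then show ?thesis unfolding posunit_def using r by (metis linorder_neqE_linordered_idom neg_0_less_iff_less)
qed

lemma posunit_1_add: "i \<in> M \<Longrightarrow> posunit (1 + i)"
  unfolding posunit_def by (intro exI[of _ 1]) simp

lemma posunit_of_real: "r > 0 \<Longrightarrow> posunit (of_real r)"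
  unfolding posunit_def by (intro exI[of _ r]) (simp add: M_def)

lemma posunit_add:
  assumes "posunit u" "posunit u'"
  shows "posunit (u + u')"
proof -
  obtain r s where "r > 0" "u - of_real r \<in> M" "s > 0" "u' - of_real s \<in> M"
    using assms by (auto simp: posunit_def)
  then show ?thesis using M_add unfolding posunit_def
    by (intro exI[of _ "r + s"]) (force simp: algebra_simps)
qed

lemma not_posunit_minus: "posunit u \<Longrightarrow> \<not> posunit (- u)"
  using posunit_add[of u "- u"] posunit_unit(1)[of 0] by auto

lemma posunit_mult:
  assumes "posunit u" "posunit u'"
  shows "posunit (u * u')"
proof -
  obtain r s where rs: "r > 0" "u - of_real r \<in> M" "s > 0" "u' - of_real s \<in> M"
    using assms by (auto simp: posunit_def)
  have "u * u' - of_real (r * s) = (u - of_real r) * u' + of_real r * (u' - of_real s)"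
    by (simp add: algebra_simps)
  then have "u * u' - of_real (r * s) \<in> M"
    using M_add[OF M_mult_unit[OF rs(2)] M_unit_mult[OF rs(4)]] posunit_unit assms w_of_real[of r] rs(1)
    by simp
  then show ?thesis unfolding posunit_def using rs by (intro exI[of _ "r * s"]) simp
qed

lemma posunit_inverse:
  assumes "posunit u"
  shows "posunit (inverse u)"
proof -
  obtain r where r: "r > 0" "u - of_real r \<in> M" using assms by (auto simp: posunit_def)
  have u: "u \<noteq> 0" "w u = 0" using posunit_unit assms by auto
  have "inverse u - of_real (inverse r) = - (inverse u * (u - of_real r) * of_real (inverse r))"
    using u r(1) by (simp add: algebra_simps)
  then have "inverse u - of_real (inverse r) \<in> M"
    using M_minus[OF M_mult_unit[OF M_unit_mult[OF r(2)], of "inverse u" "of_real (inverse r)"]]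
      u w_inverse[of u] w_of_real[of "inverse r"] r(1)
    by simp
  then show ?thesis unfolding posunit_def using r by (intro exI[of _ "inverse r"]) simp
qed

text \<open>Real scalars are central and \<open>M\<close> is stable under conjugation, so conjugate
  units have the same residue.\<close>

lemma posunit_conj:
  assumes "posunit u" "a \<noteq> 0"
  shows "posunit (a * u * inverse a)"
proof -
  obtain r where r: "r > 0" "u - of_real r \<in> M" using assms by (auto simp: posunit_def)
  have "a * of_real r * inverse a = of_real r"
    using assms(2) by (simp add: of_real_def)
  then have "a * u * inverse a - of_real r = a * (u - of_real r) * inverse a"
    by (simp add: algebra_simps)
  then show ?thesis unfolding posunit_def using r M_conj[OF assms(2) r(2)] by auto
qed

lemma posunit_square: "u \<noteq> 0 \<Longrightarrow> w u = 0 \<Longrightarrow> posunit (u * u)"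
  using posunit_cases[of u] posunit_mult[of u u] posunit_mult[of "- u" "- u"] by auto

text \<open>\<open>a * inverse b\<close> is \<open>1 + (a - b) * inverse b\<close> with second
  summand in \<open>M\<close>. This turns compatibility into a condition on units.\<close>

lemma posunit_of_compatible:
  assumes "a \<noteq> 0" "b \<noteq> 0" "v b < v (a - b)"
  shows "posunit (a * inverse b)"
proof -
  have "(a - b) * inverse b \<in> M"
  proof (cases "a = b")
    case False
    then have "w b < w (a - b)" using assms by (simp add: v_w less_le)
    from right_strict_mono[OF this, of "- w b"] show ?thesis
      using False assms by (simp add: M_def w_mult w_inverse)
  qed (simp add: M_def)
  from posunit_1_add[OF this] show ?thesis using assms by (simp add: algebra_simps)
qed

text \<open>Conversely, a positive unit and its residue form a pair to which compatibility
  applies.\<close>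

lemma compatible_of_posunit:
  assumes "posunit u"
  obtains r :: real where "r > 0" "v u = v (of_real r)" "v (of_real r) < v (u - of_real r)"
proof -
  obtain r where r: "r > 0" "u - of_real r \<in> M" using assms by (auto simp: posunit_def)
  have "v u = Fin 0" "v (of_real r) = Fin 0"
    using posunit_unit[OF assms] r w_of_real[of r] by (simp_all add: v_w)
  moreover have "Fin 0 < v (u - of_real r)"
    using r(2) by (cases "u = of_real r") (auto simp: M_def v_0 v_w less_le)
  ultimately show ?thesis using that r by metis
qed


section \<open>Orderings\<close>

text \<open>
  A precone is a set of elements that may be required to be positive; it becomes the positive cone of
  an ordering once it contains \<open>a\<close> or \<open>-a\<close> for all \<open>a \<noteq> 0\<close>. Closure under addition is a consequence.
\<close>

definition precone :: "'d set \<Rightarrow> bool" where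
  "precone S \<longleftrightarrow> (\<forall>u. posunit u \<longrightarrow> u \<in> S) \<and> (\<forall>a. a \<noteq> 0 \<longrightarrow> a * a \<in> S) \<and>
     (\<forall>a\<in>S. \<forall>b\<in>S. a * b \<in> S) \<and> 0 \<notin> S \<and> - 1 \<notin> S"

lemma preconeD:
  assumes "precone S"
  shows "posunit u \<Longrightarrow> u \<in> S" "a \<noteq> 0 \<Longrightarrow> a * a \<in> S" "a \<in> S \<Longrightarrow> b \<in> S \<Longrightarrow> a * b \<in> S"
    "0 \<notin> S" "- 1 \<notin> S"
  using assms by (auto simp: precone_def)

lemma precone_inverse:
  assumes "precone S" "a \<in> S"
  shows "inverse a \<in> S"
proof -
  have "a \<noteq> 0" using assms preconeD(4) by blast
  then have "a * (inverse a * inverse a) = inverse a" by (simp add: mult.assoc[symmetric])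
  then show ?thesis using preconeD(3)[OF assms] preconeD(2)[OF assms(1), of "inverse a"] \<open>a \<noteq> 0\<close>
    by force
qed

lemma precone_not_minus:
  assumes "precone S" "a \<in> S"
  shows "- a \<notin> S"
proof
  assume "- a \<in> S"
  then have "- a * inverse a \<in> S" using assms precone_inverse preconeD(3) by blast
  moreover have "a \<noteq> 0" using assms preconeD(4) by blast
  ultimately show False using preconeD(5)[OF assms(1)] by simp
qed

text \<open>If \<open>t\<close> is a unit, its residue is positive, since otherwise
  \<open>- t\<close> would be in \<open>S\<close>; if not, \<open>t\<close> lies in
  \<open>M\<close>. Either way \<open>1 + t\<close> is a positive unit.\<close>

lemma precone_add_1:
  assumes "precone S" "t \<in> S" "0 \<le> w t"
  shows "1 + t \<in> S"
proof -
  have "t \<noteq> 0" using assms preconeD(4) by blast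
  have "posunit (1 + t)"
  proof (cases "w t = 0")
    case True
    have "\<not> posunit (- t)" using precone_not_minus[OF assms(1,2)] preconeD(1)[OF assms(1)] by blast
    then have "posunit t" using posunit_cases[OF \<open>t \<noteq> 0\<close> True] by blast
    then show ?thesis using posunit_add posunit_of_real[of 1] by simp
  next
    case False
    then have "t \<in> M" using assms(3) by (simp add: M_def less_le)
    then show ?thesis by (rule posunit_1_add)
  qed
  then show ?thesis using preconeD(1)[OF assms(1)] by blast
qed

text \<open>Factor out the summand of smaller value:
  \<open>a + b = a * (1 + inverse a * b)\<close>.\<close>

lemma precone_add:
  assumes S: "precone S" and ab: "a \<in> S" "b \<in> S"
  shows "a + b \<in> S"
proof -
  have *: "a + b \<in> S" if "a \<in> S" "b \<in> S" "w a \<le> w b" for a b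
  proof -
    have ab: "a \<noteq> 0" "b \<noteq> 0" using that S preconeD(4) by blast+
    have t: "inverse a * b \<in> S" using that S precone_inverse preconeD(3) by blast
    have "0 \<le> w (inverse a * b)" using left_mono[OF that(3), of "- w a"] ab
      by (simp add: w_mult w_inverse)
    then have "a * (1 + inverse a * b) \<in> S" using precone_add_1[OF S t] preconeD(3)[OF S] that by blast
    then show ?thesis using ab by (simp add: algebra_simps mult.assoc[symmetric])
  qed
  show ?thesis using *[of a b] *[of b a] ab by (metis add.commute linear)
qed

lemma precone_ordering:
  assumes S: "precone S" and total: "\<And>a. a \<noteq> 0 \<Longrightarrow> a \<in> S \<or> - a \<in> S"
  shows "insert 0 S \<in> compatible_orderings v"
proof -
  have "division_ring_ordering (insert 0 S)"
    unfolding division_ring_ordering_def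
  proof (intro conjI ballI)
    show "a + b \<in> insert 0 S" "a * b \<in> insert 0 S" if "a \<in> insert 0 S" "b \<in> insert 0 S" for a b
      using that precone_add[OF S] preconeD(3)[OF S] by auto
    have "a \<in> insert 0 S \<union> uminus ` insert 0 S" for a
      using total[of a] by (metis UnI1 UnI2 imageI insertCI minus_minus)
    then show "insert 0 S \<union> uminus ` insert 0 S = UNIV" by blast
    show "insert 0 S \<inter> uminus ` insert 0 S = {0}"
      using precone_not_minus[OF S] by auto
  qed
  moreover have "a * b \<in> S" if "a \<noteq> 0" "b \<noteq> 0" "v b < v (a - b)" for a b
  proof -
    \<comment> \<open>Compatibility: \<open>a * b\<close> is a positive unit times the square of
      \<open>b\<close>.\<close>
    have "a * inverse b * (b * b) \<in> S"
      using preconeD[OF S] posunit_of_compatible[OF that] that by blast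
    moreover have "a * inverse b * (b * b) = a * (inverse b * b) * b" by (simp only: mult.assoc)
    ultimately show ?thesis using that by simp
  qed
  ultimately show ?thesis by (auto simp: compatible_orderings_def compatible_with_def)
qed

lemma ordering_precone:
  assumes P: "P \<in> compatible_orderings v"
  shows "precone (P - {0})" and "a \<in> P \<or> - a \<in> P" and "a \<in> P \<Longrightarrow> - a \<in> P \<Longrightarrow> a = 0" and "0 \<in> P"
proof -
  have o: "division_ring_ordering P" and c: "compatible_with v P"
    using P by (auto simp: compatible_orderings_def)
  have mult: "a * b \<in> P" if "a \<in> P" "b \<in> P" for a b
    using o that by (simp add: division_ring_ordering_def)
  have un: "P \<union> uminus ` P = UNIV" and int: "P \<inter> uminus ` P = {0}"
    using o by (simp_all add: division_ring_ordering_def)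
  have total: "a \<in> P \<or> - a \<in> P" for a
  proof -
    have "a \<in> P \<union> uminus ` P" using un by simp
    then show ?thesis by auto
  qed
  have anti: "a = 0" if "a \<in> P" "- a \<in> P" for a
  proof -
    have "a \<in> P \<inter> uminus ` P" using that by (metis IntI imageI minus_minus)
    then show ?thesis using int by simp
  qed
  have square: "a * a \<in> P" for a
    using total[of a] mult[of a a] mult[of "- a" "- a"] by auto
  have "u \<in> P" if u: "posunit u" for u
  proof -
    obtain r :: real where r: "r > 0" "v u = v (of_real r)" "v (of_real r) < v (u - of_real r)"
      using compatible_of_posunit[OF u] by blast
    then have "u * of_real r \<in> P" using c posunit_unit[OF u] by (simp add: compatible_with_def)
    \<comment> \<open>Positive reals are squares, so the factor \<open>r\<close> can be cancelled
      inside \<open>P\<close>.\<close>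
    moreover have "of_real (inverse r) \<in> P"
      using square[of "of_real (sqrt (inverse r))"] r(1) by (simp flip: of_real_mult)
    ultimately have "u * of_real r * of_real (inverse r) \<in> P" by (rule mult)
    then show ?thesis using r(1) by (simp add: mult.assoc flip: of_real_mult)
  qed
  moreover have "- 1 \<notin> P" using anti[of 1] square[of 1] by auto
  ultimately show "precone (P - {0})"
    using mult square posunit_unit(1) by (auto simp: precone_def)
  show "a \<in> P \<or> - a \<in> P" "a \<in> P \<Longrightarrow> - a \<in> P \<Longrightarrow> a = 0" "0 \<in> P"
    using total anti int by auto
qed

section \<open>Extending precones to orderings\<close>

definition orderings_above :: "'d set \<Rightarrow> 'd set set" where
  "orderings_above S = {P \<in> compatible_orderings v. S \<subseteq> P}"

text \<open>A further nonzero \<open>a\<close> in \<open>P\<close> would have \<open>- a\<close> in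
  \<open>S\<close>, hence also in \<open>P\<close>.\<close>

lemma orderings_above_total:
  assumes S: "precone S" and total: "\<And>a. a \<noteq> 0 \<Longrightarrow> a \<in> S \<or> - a \<in> S"
  shows "orderings_above S = {insert 0 S}"
proof -
  have "P = insert 0 S" if P: "P \<in> compatible_orderings v" "S \<subseteq> P" for P
  proof -
    have "a \<in> insert 0 S" if "a \<in> P" for a
      using ordering_precone(3)[OF P(1) that] total[of a] P(2) by auto
    then show ?thesis using ordering_precone(4)[OF P(1)] P(2) by auto
  qed
  then show ?thesis using precone_ordering[OF assms] by (auto simp: orderings_above_def)
qed

text \<open>Intended as the group generated by \<open>S\<close> and \<open>f\<close>: two cosets are
  enough because \<open>f * f\<close> already lies in a precone \<open>S\<close>.\<close>

definition adjoin :: "'d \<Rightarrow> 'd set \<Rightarrow> 'd set" where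
  "adjoin f S = S \<union> (*) f ` S"

lemma adjoin_iff:
  assumes "f \<noteq> 0"
  shows "a \<in> adjoin f S \<longleftrightarrow> a \<in> S \<or> inverse f * a \<in> S"
proof -
  have "a \<in> (*) f ` S \<longleftrightarrow> inverse f * a \<in> S"
    using assms by (auto simp: mult.assoc[symmetric] image_iff intro!: bexI[of _ "inverse f * a"])
  then show ?thesis by (simp add: adjoin_def)
qed

text \<open>Every ordering contains exactly one of \<open>f\<close> and \<open>- f\<close>.\<close>

lemma orderings_above_split:
  assumes S: "precone S" and f: "f \<noteq> 0"
  shows "orderings_above S = orderings_above (adjoin f S) \<union> orderings_above (adjoin (- f) S)"
    and "orderings_above (adjoin f S) \<inter> orderings_above (adjoin (- f) S) = {}"
proof -
  have 1: "1 \<in> S" using preconeD(2)[OF S, of 1] by simp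
  have iff: "adjoin g S \<subseteq> P \<longleftrightarrow> S \<subseteq> P \<and> g \<in> P" if P: "P \<in> compatible_orderings v" and g: "g \<noteq> 0" for P g
  proof
    assume "adjoin g S \<subseteq> P"
    then show "S \<subseteq> P \<and> g \<in> P" using 1 by (force simp: adjoin_def)
  next
    assume *: "S \<subseteq> P \<and> g \<in> P"
    have "g * s \<in> P" if "s \<in> S" for s
      using preconeD(3)[OF ordering_precone(1)[OF P], of g s] * that g preconeD(4)[OF S] by blast
    then show "adjoin g S \<subseteq> P" using * by (auto simp: adjoin_def)
  qed
  show "orderings_above S = orderings_above (adjoin f S) \<union> orderings_above (adjoin (- f) S)"
  proof (rule Set.set_eqI)
    fix P
    show "P \<in> orderings_above S \<longleftrightarrow> P \<in> orderings_above (adjoin f S) \<union> orderings_above (adjoin (- f) S)"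
      using iff[of P f] iff[of P "- f"] f ordering_precone(2)[of P f]
      unfolding orderings_above_def by (cases "P \<in> compatible_orderings v") (simp_all, blast)
  qed
  show "orderings_above (adjoin f S) \<inter> orderings_above (adjoin (- f) S) = {}"
    using iff[of _ f] iff[of _ "- f"] f ordering_precone(3)[of _ f] by (auto simp: orderings_above_def)
qed

end

text \<open>This condition allows factors to be interchanged at the cost of a positive unit;
  \<open>posunit_K\<close> supplies it for the Weyl algebra.\<close>

locale commuting_residues = real_residue_valuation v
  for v :: "'d::real_div_algebra \<Rightarrow> 'g::totally_ordered_group with_infty" +
  assumes posunit_commutator:
    "a \<noteq> 0 \<Longrightarrow> b \<noteq> 0 \<Longrightarrow> posunit (a * b * inverse a * inverse b)"
begin

text \<open>Commutators lie in \<open>S\<close>, so \<open>f\<close> can be moved to the left past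
  elements of \<open>S\<close>, and \<open>f * f\<close> is absorbed. If \<open>-1\<close> were in
  the coset of \<open>f\<close>, then \<open>- inverse f\<close>, hence \<open>- f\<close>, would be
  in \<open>S\<close>.\<close>

lemma precone_adjoin:
  assumes S: "precone S" and f: "f \<noteq> 0" "- f \<notin> S"
  shows "precone (adjoin f S)"
  unfolding precone_def
proof (intro conjI ballI allI impI)
  show "u \<in> adjoin f S" if "posunit u" for u using preconeD(1)[OF S that] by (simp add: adjoin_def)
  show "a * a \<in> adjoin f S" if "a \<noteq> 0" for a using preconeD(2)[OF S that] by (simp add: adjoin_def)
  show "0 \<notin> adjoin f S" using f preconeD(4)[OF S] by (auto simp: adjoin_def)
  show "- 1 \<notin> adjoin f S"
  proof
    assume "- 1 \<in> adjoin f S"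
    then have "- inverse f \<in> S" using adjoin_iff[OF f(1)] preconeD(5)[OF S] by auto
    from precone_inverse[OF S this] show False using f by simp
  qed
  fix a b assume ab: "a \<in> adjoin f S" "b \<in> adjoin f S"
  have swap: "s * f * t = f * (inverse f * s * f * inverse s) * s * t" if "s \<noteq> 0" for s t
  proof -
    have "f * (inverse f * s * f * inverse s) * s * t = (f * inverse f) * s * f * (inverse s * s) * t"
      by (simp only: mult.assoc)
    also have "\<dots> = s * f * t" using f that by simp
    finally show ?thesis by (rule HOL.sym)
  qed
  have pos: "inverse f * s * f * inverse s \<in> S" if "s \<in> S" for s
  proof -
    have "s \<noteq> 0" using that preconeD(4)[OF S] by blast
    then have "posunit (inverse f * s * f * inverse s)"
      using posunit_commutator[of "inverse f" s] f(1) by simp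
    then show ?thesis by (rule preconeD(1)[OF S])
  qed
  have move: "inverse f * (s * f * t) \<in> S" if "s \<in> S" "t \<in> S" for s t
  proof -
    have "s \<noteq> 0" using that preconeD(4)[OF S] by blast
    have "inverse f * (s * f * t) = (inverse f * f) * (inverse f * s * f * inverse s) * s * t"
      unfolding swap[OF \<open>s \<noteq> 0\<close>] by (simp only: mult.assoc)
    then show ?thesis
      using f(1) preconeD(3)[OF S preconeD(3)[OF S pos[OF that(1)] that(1)] that(2)] by simp
  qed
  have "a \<in> S \<or> (\<exists>s\<in>S. a = f * s)" "b \<in> S \<or> (\<exists>t\<in>S. b = f * t)"
    using ab by (auto simp: adjoin_def)
  then consider (1) "a \<in> S" "b \<in> S" | (2) s where "s \<in> S" "a = f * s" "b \<in> S"
    | (3) t where "a \<in> S" "t \<in> S" "b = f * t" | (4) s t where "s \<in> S" "a = f * s" "t \<in> S" "b = f * t"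
    by blast
  then show "a * b \<in> adjoin f S"
  proof cases
    case 1
    then have "a * b \<in> S" using preconeD(3)[OF S] by blast
    then show ?thesis by (simp add: adjoin_def)
  next
    case 2
    then have "s * b \<in> S" using preconeD(3)[OF S] by blast
    then show ?thesis unfolding adjoin_def 2(2) mult.assoc by blast
  next
    case 3
    show ?thesis
      unfolding adjoin_iff[OF f(1)] 3(3) using move[OF 3(1,2)] unfolding mult.assoc by blast
  next
    case 4
    have "f * inverse f = 1" using f(1) by simp
    then have "f * s * (f * t) = f * (f * inverse f) * (s * f * t)" by (simp add: mult.assoc)
    also have "\<dots> = f * f * (inverse f * (s * f * t))" by (simp only: mult.assoc)
    finally have "a * b = f * f * (inverse f * (s * f * t))" unfolding 4 .
    then show ?thesis
      using preconeD(3)[OF S preconeD(2)[OF S f(1)] move[OF 4(1,3)]] by (simp add: adjoin_def)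
  qed
qed

lemma adjoin_neither:
  assumes "precone S" "f \<noteq> 0" "f \<notin> S" "- f \<notin> S"
  shows "precone (adjoin f S)" "precone (adjoin (- f) S)"
  using precone_adjoin assms by auto

text \<open>The last hypothesis says that \<open>f\<close> represents the only remaining class
  modulo sign, so adjoining \<open>f\<close> or \<open>- f\<close> already determines an
  ordering.\<close>

lemma card_orderings_above_2:
  assumes S: "precone S" and f: "f \<noteq> 0" "f \<notin> S" "- f \<notin> S"
    and total: "\<And>a. a \<noteq> 0 \<Longrightarrow> a \<in> S \<or> - a \<in> S \<or> inverse f * a \<in> S \<or> - (inverse f * a) \<in> S"
  shows "card (orderings_above S) = 2"
proof -
  have "a \<in> adjoin f S \<or> - a \<in> adjoin f S" "a \<in> adjoin (- f) S \<or> - a \<in> adjoin (- f) S"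
    if "a \<noteq> 0" for a
    using total[OF that] f adjoin_iff[of f] adjoin_iff[of "- f"] by auto
  then have "orderings_above (adjoin f S) = {insert 0 (adjoin f S)}"
    and "orderings_above (adjoin (- f) S) = {insert 0 (adjoin (- f) S)}"
    using orderings_above_total[OF adjoin_neither(1)[OF S f]]
      orderings_above_total[OF adjoin_neither(2)[OF S f]] by simp_all
  then show ?thesis using orderings_above_split[OF S f(1)] by (auto simp: card_insert_if)
qed

text \<open>The smallest precone; one unit and one square suffice because products can be
  rearranged.\<close>

definition N :: "'d set" where
  "N = {u * (b * b) | u b. posunit u \<and> b \<noteq> 0}"

text \<open>If \<open>u * (b * b) = - 1\<close>, then \<open>w b = 0\<close> by absence of
  2-torsion, so the left side is a positive unit and \<open>- 1\<close> is not. For products, two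
  squares merge into one up to a commutator.\<close>

lemma precone_N: "precone N"
  unfolding precone_def
proof (intro conjI ballI allI impI)
  show "u \<in> N" if "posunit u" for u
    unfolding N_def using that by (force intro: exI[of _ u] exI[of _ 1])
  show "a * a \<in> N" if "a \<noteq> 0" for a
    unfolding N_def using that posunit_of_real[of 1] by (force intro: exI[of _ 1] exI[of _ a])
  show "0 \<notin> N" unfolding N_def using posunit_unit by auto
  show "- 1 \<notin> N"
  proof
    assume "- 1 \<in> N"
    then obtain u b where ub: "posunit u" "b \<noteq> 0" "u * (b * b) = - 1" unfolding N_def by auto
    then have "w u + (w b + w b) = 0"
      using w_mult[of u "b * b"] w_mult[of b b] posunit_unit(1)[OF ub(1)] w_minus[of 1] w_1 by simp
    then have "w b = 0" using posunit_unit[OF ub(1)] by (simp add: double_eq_0_iff)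
    then have "posunit (- 1)" using posunit_mult[OF ub(1) posunit_square] ub by force
    then show False using not_posunit_minus posunit_of_real[of 1] by simp
  qed
  fix a a' assume "a \<in> N" "a' \<in> N"
  then obtain u b u' b' where
    a: "posunit u" "b \<noteq> 0" "a = u * (b * b)" and a': "posunit u'" "b' \<noteq> 0" "a' = u' * (b' * b')"
    unfolding N_def by auto
  \<comment> \<open>The second factor moves \<open>u'\<close> past \<open>b * b\<close>; the third,
    a conjugated commutator, turns the square of \<open>b * b'\<close> into
    \<open>b * b * (b' * b')\<close>.\<close>
  let ?u = "u * (b * b * u' * inverse (b * b)) * (b * (b * b' * inverse b * inverse b') * inverse b)"
  have "?u * (b * b' * (b * b')) = u * (b * b * u' * (inverse (b * b) * (b * b))) *
      (b' * inverse b * (inverse b' * (inverse b * b) * b') * (b * b'))"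
    by (simp only: mult.assoc)
  also have "\<dots> = u * (b * b * u') * (b' * (inverse b * (inverse b' * 1 * b') * (b * b')))"
    using a a' by (simp add: mult.assoc)
  also have "\<dots> = u * (b * b * u') * (b' * (inverse b * b) * b')" using a' by (simp add: mult.assoc)
  also have "\<dots> = u * (b * b * u') * (b' * b')" using a by simp
  also have "\<dots> = a * a'" unfolding a(3) a'(3) by (simp only: mult.assoc)
  finally have "a * a' = ?u * (b * b' * (b * b'))" ..
  moreover have "posunit ?u"
    using a a' by (intro posunit_mult posunit_conj posunit_commutator) auto
  ultimately show "a * a' \<in> N" unfolding N_def using a(2) a'(2)
    by (intro CollectI exI[of _ ?u] exI[of _ "b * b'"]) auto
qed

text \<open>If the values agree, \<open>a\<close> and \<open>d * d\<close> differ by a unit, which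
  is positive up to sign. So membership modulo sign depends only on the value modulo
  doubles.\<close>

lemma N_cases:
  assumes "a \<noteq> 0"
  shows "a \<in> N \<or> - a \<in> N \<longleftrightarrow> (\<exists>d. d \<noteq> 0 \<and> w a = w d + w d)"
proof
  assume "a \<in> N \<or> - a \<in> N"
  then obtain u d where "posunit u" "d \<noteq> 0" "a = u * (d * d) \<or> - a = u * (d * d)"
    unfolding N_def by auto
  then show "\<exists>d. d \<noteq> 0 \<and> w a = w d + w d"
    using posunit_unit[of u] w_minus[of a] w_mult[of u "d * d"] w_mult[of d d] by auto
next
  assume "\<exists>d. d \<noteq> 0 \<and> w a = w d + w d"
  then obtain d where d: "d \<noteq> 0" "w a = w d + w d" by blast
  let ?u = "a * inverse (d * d)"
  have "?u \<noteq> 0" "w ?u = 0" using assms d by (simp_all add: w_mult w_inverse)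
  then have "posunit ?u \<or> posunit (- ?u)" by (rule posunit_cases)
  moreover have "a = ?u * (d * d)" using d by (simp add: mult.assoc)
  moreover from this have "- a = - ?u * (d * d)" by simp
  ultimately show "a \<in> N \<or> - a \<in> N" unfolding N_def using d(1) by blast
qed

lemma orderings_above_N: "orderings_above N = compatible_orderings v"
proof -
  have "N \<subseteq> P" if "P \<in> compatible_orderings v" for P
    using preconeD[OF ordering_precone(1)[OF that]] unfolding N_def by blast
  then show ?thesis by (auto simp: orderings_above_def)
qed

end

section \<open>Residues of commutators\<close>

text \<open>The pair \<open>(c1, c2)\<close> embeds \<open>\<Gamma>/2\<Gamma>\<close> into \<open>(\<int>/2\<int>)\<^sup>2\<close>.\<close>

locale square_classes = real_residue_valuation v
  for v :: "'d::real_div_algebra \<Rightarrow> 'g::totally_ordered_group with_infty" +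
  fixes c1 c2 :: "'g \<Rightarrow> bool"
  assumes w_commute: "a \<noteq> 0 \<Longrightarrow> b \<noteq> 0 \<Longrightarrow> w a + w b = w b + w a"
    and c1_add: "a \<noteq> 0 \<Longrightarrow> b \<noteq> 0 \<Longrightarrow> c1 (w a + w b) \<longleftrightarrow> c1 (w a) \<noteq> c1 (w b)"
    and c2_add: "a \<noteq> 0 \<Longrightarrow> b \<noteq> 0 \<Longrightarrow> c2 (w a + w b) \<longleftrightarrow> c2 (w a) \<noteq> c2 (w b)"
    and c_double: "a \<noteq> 0 \<Longrightarrow> \<not> c1 (w a) \<Longrightarrow> \<not> c2 (w a) \<Longrightarrow> \<exists>d. d \<noteq> 0 \<and> w a = w d + w d"
begin

lemma c_0: "\<not> c1 0" "\<not> c2 0"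
  using c1_add[of 1 1] c2_add[of 1 1] w_1 by auto

lemma c_inverse:
  assumes "a \<noteq> 0"
  shows "c1 (w (inverse a)) = c1 (w a)" "c2 (w (inverse a)) = c2 (w a)"
  using c1_add[OF assms, of "inverse a"] c2_add[OF assms, of "inverse a"] assms c_0
  by (simp_all add: w_inverse)

lemma c_mult:
  assumes "a \<noteq> 0" "b \<noteq> 0"
  shows "c1 (w (a * b)) \<longleftrightarrow> c1 (w a) \<noteq> c1 (w b)" "c2 (w (a * b)) \<longleftrightarrow> c2 (w a) \<noteq> c2 (w b)"
  using c1_add[OF assms] c2_add[OF assms] assms by (simp_all add: w_mult)

lemma c_add_self: "d \<noteq> 0 \<Longrightarrow> \<not> c1 (w d + w d) \<and> \<not> c2 (w d + w d)"
  by (simp add: c1_add c2_add)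

definition K :: "'d \<Rightarrow> 'd \<Rightarrow> 'd" where
  "K a b = a * b * inverse a * inverse b"

lemma K_unit: "a \<noteq> 0 \<Longrightarrow> b \<noteq> 0 \<Longrightarrow> K a b \<noteq> 0 \<and> w (K a b) = 0"
  using w_commute[of a b] by (simp add: K_def w_mult w_inverse add.assoc[symmetric])

lemma K_sym: "a \<noteq> 0 \<Longrightarrow> b \<noteq> 0 \<Longrightarrow> K b a = inverse (K a b)"
  by (simp add: K_def nonzero_inverse_mult_distrib mult.assoc)

text \<open>As conjugation preserves residues, this makes the sign of \<open>K\<close>
  multiplicative in its second argument.\<close>

lemma K_mult:
  assumes "a \<noteq> 0" "b \<noteq> 0" "c \<noteq> 0"
  shows "K a (b * c) = K a b * (b * K a c * inverse b)"
proof -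
  have "K a b * (b * K a c * inverse b)
      = a * b * (inverse a * (inverse b * b) * a) * c * inverse a * (inverse c * inverse b)"
    by (simp only: K_def mult.assoc)
  then show ?thesis using assms by (simp add: K_def nonzero_inverse_mult_distrib mult.assoc)
qed

lemma posK_sym: "a \<noteq> 0 \<Longrightarrow> b \<noteq> 0 \<Longrightarrow> posunit (K a b) \<Longrightarrow> posunit (K b a)"
  by (metis K_sym posunit_inverse)

lemma posK_self: "a \<noteq> 0 \<Longrightarrow> posunit (K a a)"
  using posunit_of_real[of 1] by (simp add: K_def mult.assoc)

lemma posK_mult:
  "a \<noteq> 0 \<Longrightarrow> b \<noteq> 0 \<Longrightarrow> c \<noteq> 0 \<Longrightarrow> posunit (K a b) \<Longrightarrow> posunit (K a c) \<Longrightarrow> posunit (K a (b * c))"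
  by (simp add: K_mult posunit_mult posunit_conj)

text \<open>The sign of \<open>K a d\<close> occurs twice and cancels.\<close>

lemma posK_square:
  assumes "a \<noteq> 0" "d \<noteq> 0"
  shows "posunit (K a (d * d))"
  using posunit_cases[of "K a d"] K_unit[OF assms]
    posunit_mult[OF _ posunit_conj[OF _ assms(2)], of "K a d" "K a d"]
    posunit_mult[OF _ posunit_conj[OF _ assms(2)], of "- K a d" "- K a d"]
  by (auto simp: K_mult assms)

text \<open>\<open>K a u\<close> is a conjugate of \<open>u\<close> times \<open>inverse u\<close>,
  so its residue is 1.\<close>

lemma posK_unit:
  assumes "a \<noteq> 0" "u \<noteq> 0" "w u = 0"
  shows "posunit (K a u)"
proof -
  have *: "posunit (K a u)" if "posunit u" for u
    using posunit_mult[OF posunit_conj[OF that assms(1)] posunit_inverse[OF that]]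
    by (simp add: K_def)
  have "K a (- u) = K a u" by (simp add: K_def)
  then show ?thesis using * posunit_cases[OF assms(2,3)] by metis
qed

lemma posK_double:
  assumes "a \<noteq> 0" "b \<noteq> 0" "d \<noteq> 0" "w b = w d + w d"
  shows "posunit (K a b)"
proof -
  let ?u = "b * inverse (d * d)"
  have "?u \<noteq> 0" "w ?u = 0" using assms by (simp_all add: w_mult w_inverse)
  then have "posunit (K a (?u * (d * d)))"
    using posK_mult[OF assms(1) _ _ posK_unit posK_square] assms by simp
  moreover have "?u * (d * d) = b" using assms by (simp add: mult.assoc)
  ultimately show ?thesis by simp
qed

text \<open>\<open>b * inverse b'\<close> has trivial class, so its value is a double and
  \<open>posK_double\<close> applies to it.\<close>

lemma posK_class:
  assumes "a \<noteq> 0" "b \<noteq> 0" "b' \<noteq> 0" "c1 (w b) = c1 (w b')" "c2 (w b) = c2 (w b')" "posunit (K a b')"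
  shows "posunit (K a b)"
proof -
  have nz: "b * inverse b' \<noteq> 0" using assms by simp
  have "\<not> c1 (w (b * inverse b'))" "\<not> c2 (w (b * inverse b'))"
    using assms by (simp_all add: c_mult c_inverse)
  from c_double[OF nz this] have "posunit (K a (b * inverse b'))"
    using posK_double[OF assms(1) nz] by blast
  then have "posunit (K a (b * inverse b' * b'))" using posK_mult assms nz by blast
  then show ?thesis using assms by (simp add: mult.assoc)
qed

text \<open>Two distinct nonzero classes generate the Klein four-group, so \<open>1\<close>,
  \<open>f\<close>, \<open>g\<close>, \<open>f * g\<close> represent all possible classes.\<close>

lemma posK_generate:
  assumes "a \<noteq> 0" "f \<noteq> 0" "g \<noteq> 0" "posunit (K a f)" "posunit (K a g)"
    and f: "c1 (w f) \<or> c2 (w f)" and g: "c1 (w g) \<or> c2 (w g)"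
    and fg: "c1 (w f) \<noteq> c1 (w g) \<or> c2 (w f) \<noteq> c2 (w g)"
    and z: "z \<noteq> 0"
  shows "posunit (K a z)"
proof -
  have "posunit (K a (f * g))" "posunit (K a 1)"
    using posK_mult[OF assms(1,2,3)] assms(4,5) posK_unit[OF assms(1), of 1] w_1 by simp_all
  then have pos: "b \<noteq> 0 \<and> posunit (K a b)" if "b \<in> {1, f, g, f * g}" for b
    using that assms(2-5) by auto
  have "\<exists>b\<in>{1, f, g, f * g}. c1 (w z) = c1 (w b) \<and> c2 (w z) = c2 (w b)"
    using f g fg assms(2,3) by (simp add: c_mult w_1 c_0) blast
  then obtain b where b: "b \<in> {1, f, g, f * g}" "c1 (w z) = c1 (w b)" "c2 (w z) = c2 (w b)" by blast
  show ?thesis by (rule posK_class[OF assms(1) z _ b(2,3)]) (use pos[OF b(1)] in simp_all)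
qed

end

locale weyl_square_classes = square_classes v c1 c2 + weyl_pair X Y
  for v :: "'d::real_div_algebra \<Rightarrow> 'g::totally_ordered_group with_infty" and c1 c2 and X Y :: 'd +
  assumes fractions: "\<exists>p q k. p \<in> V k \<and> q \<in> V k \<and> q \<noteq> 0 \<and> a = p * inverse q"
begin

text \<open>The trivial class and \<open>(x, y)\<close> form a subgroup, so it contains the classes
  of all fractions once it contains those of polynomials. It is used contrapositively, to find
  polynomials outside the subgroup.\<close>

lemma fraction_class:
  assumes "a \<noteq> 0"
    and R: "\<And>p k. p \<in> V k \<Longrightarrow> p \<noteq> 0 \<Longrightarrow>
      \<not> c1 (w p) \<and> \<not> c2 (w p) \<or> (c1 (w p) \<longleftrightarrow> x) \<and> (c2 (w p) \<longleftrightarrow> y)"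
  shows "\<not> c1 (w a) \<and> \<not> c2 (w a) \<or> (c1 (w a) \<longleftrightarrow> x) \<and> (c2 (w a) \<longleftrightarrow> y)"
proof -
  obtain p q k where pq: "p \<in> V k" "q \<in> V k" "q \<noteq> 0" "a = p * inverse q" using fractions by blast
  then have "p \<noteq> 0" using assms(1) by auto
  then show ?thesis using R[OF pq(1)] R[OF pq(2,3)] pq(3) unfolding pq(4) by (auto simp: c_mult c_inverse)
qed

text \<open>A witness of minimal degree; the bound is a successor because \<open>V 0\<close> has no
  nonzero element.\<close>

lemma V_least:
  assumes "f \<in> V k" "f \<noteq> 0" "P f"
  obtains n g where "g \<in> V (Suc n)" "g \<noteq> 0" "P g" "\<And>h. h \<in> V n \<Longrightarrow> h \<noteq> 0 \<Longrightarrow> \<not> P h"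
proof -
  let ?Q = "\<lambda>k. \<exists>f. f \<in> V k \<and> f \<noteq> 0 \<and> P f"
  have "?Q k" "\<not> ?Q 0" using assms by auto
  from ex_least_nat_less[of ?Q, OF this] obtain n where n: "\<not> ?Q n" "?Q (Suc n)" by blast
  then show ?thesis using that[of _ n] by blast
qed

lemma posunit_K:
  assumes a: "a \<noteq> 0" and b: "b \<noteq> 0"
  shows "posunit (K a b)"
proof (rule ccontr)
  assume neg: "\<not> posunit (K a b)"
  \<comment> \<open>The sign form is alternating and trivial on doubles, so a negative sign puts
    \<open>a\<close> and \<open>b\<close> into distinct nontrivial classes.\<close>
  have 1: "c1 (w b) \<or> c2 (w b)" using neg c_double[OF b] posK_double[OF a b] by blast
  have 2: "c1 (w a) \<or> c2 (w a)" using neg c_double[OF a] posK_double[OF b a] posK_sym[OF b a] by blast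
  have 3: "c1 (w a) \<noteq> c1 (w b) \<or> c2 (w a) \<noteq> c2 (w b)"
    using neg posK_class[OF a b a] posK_self[OF a] by blast
  have "\<exists>p k. p \<in> V k \<and> p \<noteq> 0 \<and> (c1 (w p) \<or> c2 (w p))"
    using fraction_class[OF a, of False False] 2 by blast
  then obtain n f where f: "f \<in> V (Suc n)" "f \<noteq> 0" "c1 (w f) \<or> c2 (w f)"
    and f_min: "\<And>h. h \<in> V n \<Longrightarrow> h \<noteq> 0 \<Longrightarrow> \<not> (c1 (w h) \<or> c2 (w h))"
    using V_least[of _ _ "\<lambda>p. c1 (w p) \<or> c2 (w p)"] by metis
  \<comment> \<open>The class of \<open>p\<close> lies outside the subgroup generated by that of
    \<open>f\<close>. This subgroup has one nonzero element, so it misses the class of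
    \<open>a\<close> or of \<open>b\<close>.\<close>
  let ?G = "\<lambda>p. (c1 (w p) \<or> c2 (w p)) \<and> (c1 (w f) \<noteq> c1 (w p) \<or> c2 (w f) \<noteq> c2 (w p))"
  have "\<exists>p k. p \<in> V k \<and> p \<noteq> 0 \<and> ?G p"
    using fraction_class[OF a, of "c1 (w f)" "c2 (w f)"]
      fraction_class[OF b, of "c1 (w f)" "c2 (w f)"] 1 2 3 by blast
  then obtain m g where g: "g \<in> V (Suc m)" "g \<noteq> 0" "?G g"
    and g_min: "\<And>h. h \<in> V m \<Longrightarrow> h \<noteq> 0 \<Longrightarrow> \<not> ?G h"
    using V_least[of _ _ ?G] by metis
  have gen: "posunit (K z z')" if "posunit (K z f)" "posunit (K z g)" "z \<noteq> 0" "z' \<noteq> 0" for z z'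
    using posK_generate[OF that(3) f(2) g(2) that(1,2) f(3)] g(3) that(4) by blast
  \<comment> \<open>Otherwise the form would vanish on the generators \<open>f\<close> and
    \<open>g\<close>, hence on \<open>a\<close> and \<open>b\<close>.\<close>
  have "\<not> posunit (K f g)"
  proof
    assume fg: "posunit (K f g)"
    have "posunit (K f a)" "posunit (K g a)"
      using gen[OF _ _ f(2) a] gen[OF _ _ g(2) a] posK_self f(2) g(2) fg posK_sym by blast+
    then show False using gen[OF _ _ a b] posK_sym a f(2) g(2) neg by blast
  qed
  then have "posunit (- K f g)" using posunit_cases K_unit f(2) g(2) by blast
  \<comment> \<open>A negative residue differs from 1, so \<open>K f g - 1\<close> is a unit and
    \<open>f * g - g * f\<close> has the value of \<open>g * f\<close>: nothing cancels.\<close>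
  then have "posunit (1 + - K f g)" using posunit_add[OF posunit_of_real[of 1], of "- K f g"] by (simp del: add_uminus_conv_diff)
  from posunit_unit[OF this] have u: "K f g - 1 \<noteq> 0" "w (K f g - 1) = 0"
    using w_minus[of "K f g - 1"] by auto
  define h where "h = f * g - g * f"
  have "K f g * (g * f) = f * g * (inverse f * (inverse g * g) * f)" by (simp only: K_def mult.assoc)
  then have h: "h = (K f g - 1) * (g * f)" using f(2) g(2) by (simp add: h_def algebra_simps)
  have h0: "h \<noteq> 0" and wh: "w h = w (g * f)" using u f(2) g(2) by (simp_all add: h w_mult)
  have "h \<in> V (n + m)" unfolding h_def using f(1) g(1) by (rule V_commutator)
  moreover have "g \<notin> V m" using g_min g by blast
  \<comment> \<open>The bound for \<open>q\<close> is \<open>n + m - m\<close>, so \<open>q\<close>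
    and \<open>r\<close> fall below the minimal degrees that define \<open>f\<close> and
    \<open>g\<close>.\<close>
  ultimately obtain q r where qr: "q \<in> V n" "r \<in> V m" "h = q * g + r"
    using V_division[OF g(1), of h "n + m"] by auto
  have r: "r = 0 \<or> \<not> ?G r" and q: "q = 0 \<or> \<not> (c1 (w q) \<or> c2 (w q))"
    using f_min[OF qr(1)] g_min[OF qr(2)] by blast+
  have Gh: "?G h" using f(2,3) g(2,3) by (auto simp: wh c_mult)
  show False
  proof (cases "q = 0")
    case True
    then show False using qr(3) r Gh h0 by auto
  next
    case False
    with q g(2) have qg: "q * g \<noteq> 0" and cqg: "c1 (w (q * g)) = c1 (w g)" "c2 (w (q * g)) = c2 (w g)"
      by (simp_all add: c_mult)
    moreover have "c1 (w h) \<longleftrightarrow> c1 (w g) \<noteq> c1 (w f)" "c2 (w h) \<longleftrightarrow> c2 (w g) \<noteq> c2 (w f)"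
      using f(2) g(2) by (simp_all add: wh c_mult)
    ultimately have "c1 (w h) \<noteq> c1 (w (q * g)) \<or> c2 (w h) \<noteq> c2 (w (q * g))" using f(3) by blast
    \<comment> \<open>\<open>q * g\<close> has the class of \<open>g\<close>, and \<open>h\<close>
      the sum of the classes of \<open>f\<close> and \<open>g\<close>. So \<open>r\<close> takes one
      of two distinct values, and either one contradicts the minimality of \<open>g\<close>.\<close>
    then have ne: "w h \<noteq> w (q * g)" by auto
    have "r = h - q * g" using qr(3) by simp
    then have "r \<noteq> 0" "w r = w h \<or> w r = w (q * g)" using ne w_diff_cases[OF h0 qg ne] by auto
    then show False using r Gh cqg g(3) by (elim disjE) simp_all
  qed
qed

end


section \<open>Counting orderings\<close>

locale commuting_square_classes = square_classes v c1 c2 + commuting_residues v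
  for v :: "'d::real_div_algebra \<Rightarrow> 'g::totally_ordered_group with_infty" and c1 c2
begin

lemma N_class: "a \<noteq> 0 \<Longrightarrow> a \<in> N \<or> - a \<in> N \<longleftrightarrow> \<not> c1 (w a) \<and> \<not> c2 (w a)"
  using N_cases[of a] c_double[of a] c_add_self by metis

lemma unique_ordering:
  assumes "\<And>a. a \<noteq> 0 \<Longrightarrow> \<not> c1 (w a) \<and> \<not> c2 (w a)"
  shows "\<exists>!P. P \<in> compatible_orderings v"
proof -
  have "orderings_above N = {insert 0 N}"
    using orderings_above_total[OF precone_N] N_class assms by blast
  then show ?thesis by (simp add: orderings_above_N)
qed

lemma two_orderings:
  assumes c2: "\<And>a. a \<noteq> 0 \<Longrightarrow> \<not> c2 (w a)" and f: "f \<noteq> 0" "c1 (w f)"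
  shows "card (compatible_orderings v) = 2"
proof -
  have "a \<in> N \<or> - a \<in> N \<or> inverse f * a \<in> N \<or> - (inverse f * a) \<in> N" if "a \<noteq> 0" for a
    using N_class[OF that] N_class[of "inverse f * a"] that f c2 by (auto simp: c_mult c_inverse)
  then show ?thesis
    using card_orderings_above_2[OF precone_N f(1)] N_class[OF f(1)] f(2) orderings_above_N by auto
qed

text \<open>Split twice: the sign of \<open>f\<close> is chosen first, then that of \<open>g\<close>
  over each of the two resulting precones.\<close>

lemma four_orderings:
  assumes f: "f \<noteq> 0" "c1 (w f)" "\<not> c2 (w f)" and g: "g \<noteq> 0" "\<not> c1 (w g)" "c2 (w g)"
  shows "card (compatible_orderings v) = 4"
proof -
  have fN: "f \<notin> N" "- f \<notin> N" using N_class[OF f(1)] f by auto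
  have two: "card (orderings_above (adjoin e N)) = 2"
    if e: "e \<noteq> 0" "c1 (w e)" "\<not> c2 (w e)" "precone (adjoin e N)" for e
  proof -
    \<comment> \<open>Once \<open>e\<close> is adjoined, only \<open>c2\<close> still obstructs
      membership up to sign.\<close>
    have iff: "a \<in> adjoin e N \<or> - a \<in> adjoin e N \<longleftrightarrow> \<not> c2 (w a)" if "a \<noteq> 0" for a
      using N_class[OF that] N_class[of "inverse e * a"] that e
      by (auto simp: adjoin_iff[OF e(1)] c_mult c_inverse)
    have "a \<in> adjoin e N \<or> - a \<in> adjoin e N \<or> inverse g * a \<in> adjoin e N \<or> - (inverse g * a) \<in> adjoin e N"
      if "a \<noteq> 0" for a
      using iff[OF that] iff[of "inverse g * a"] that g by (auto simp: c_mult c_inverse)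
    moreover have "g \<notin> adjoin e N" "- g \<notin> adjoin e N" using iff[OF g(1)] g(3) by auto
    ultimately show ?thesis using card_orderings_above_2[OF e(4) g(1)] by blast
  qed
  have "card (orderings_above (adjoin f N)) = 2" "card (orderings_above (adjoin (- f) N)) = 2"
    using two[of f] two[of "- f"] adjoin_neither[OF precone_N f(1) fN] f w_minus[of f] by simp_all
  \<comment> \<open>Nonzero cardinality gives the finiteness required for counting the disjoint
    union.\<close>
  moreover from this have "finite (orderings_above (adjoin f N))" "finite (orderings_above (adjoin (- f) N))"
    by (auto intro: card_ge_0_finite)
  ultimately show ?thesis
    using orderings_above_split[OF precone_N f(1)] orderings_above_N by (simp add: card_Un_disjoint)
qed

end

section \<open>Subgroups of the rationals modulo their doubles\<close>

lemma rat_subgroup_int_mult: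
  fixes H :: "rat set"
  assumes H: "additive_subgroup_of H" and a: "a \<in> H"
  shows "of_int k * a \<in> H"
proof (induction k rule: int_induct[where k = 0])
  case base
  then show ?case using H by (simp add: additive_subgroup_of_def)
next
  case (step1 i)
  then show ?case using H a by (simp add: additive_subgroup_of_def algebra_simps)
next
  case (step2 i)
  then have "of_int i * a + - a \<in> H" using H a unfolding additive_subgroup_of_def by blast
  then show ?case by (simp add: algebra_simps)
qed

text \<open>Two rationals generate a cyclic group; non-doubles are odd multiples of its generator,
  and a sum of two odd multiples is an even one. So \<open>H\<close> has at most two classes modulo
  doubles.\<close>

lemma rat_subgroup_odd_add:
  fixes H :: "rat set"
  assumes H: "additive_subgroup_of H" and "a \<in> H" "b \<in> H"
    and odd: "a \<notin> (\<lambda>a. a + a) ` H" "b \<notin> (\<lambda>a. a + a) ` H"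
  shows "a + b \<in> (\<lambda>a. a + a) ` H"
proof -
  obtain p q where pq: "a = of_int p / of_int q" "q \<noteq> 0" by (cases a) (auto simp: Fract_of_int_quotient)
  obtain r s where rs: "b = of_int r / of_int s" "s \<noteq> 0" by (cases b) (auto simp: Fract_of_int_quotient)
  define i j d where "i = p * s" and "j = r * q" and "d = gcd i j"
  have ab: "a = of_int i / of_int (q * s)" "b = of_int j / of_int (q * s)"
    using pq rs by (simp_all add: i_def j_def)
  obtain x y where xy: "x * i + y * j = d" unfolding d_def using bezout_int by blast
  \<comment> \<open>The Bezout combination is the cyclic generator, and it stays in
    \<open>H\<close>.\<close>
  define c where "c = of_int x * a + of_int y * b"
  have c: "c \<in> H"
    using H rat_subgroup_int_mult[OF H] assms(2,3) by (simp add: c_def additive_subgroup_of_def)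
  have cd: "c = of_int d / of_int (q * s)"
    unfolding c_def ab xy[symmetric] by (simp add: field_simps add_divide_distrib)
  obtain k l where kl: "i = d * k" "j = d * l" unfolding d_def by (meson dvdE gcd_dvd1 gcd_dvd2)
  have akl: "a = of_int k * c" "b = of_int l * c" unfolding ab cd kl by simp_all
  have half: "of_int (2 * t) * c \<in> (\<lambda>a. a + a) ` H" for t
    using rat_subgroup_int_mult[OF H c, of t] by (intro image_eqI[of _ _ "of_int t * c"]) simp_all
  have "odd k" "odd l" using odd half unfolding akl by (auto elim!: evenE)
  then have "even (k + l)" by simp
  then obtain t where t: "k + l = 2 * t" by (rule evenE)
  have "a + b = of_int (k + l) * c" by (simp add: akl algebra_simps)
  then show ?thesis using half[of t] by (simp only: t)
qed

text \<open>Not being a double is thus a homomorphism from \<open>H\<close> to the integers modulo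
  2.\<close>

lemma rat_subgroup_class_add:
  fixes H :: "rat set"
  assumes H: "additive_subgroup_of H" and "a \<in> H" "b \<in> H"
  shows "a + b \<notin> (\<lambda>a. a + a) ` H \<longleftrightarrow> (a \<notin> (\<lambda>a. a + a) ` H) \<noteq> (b \<notin> (\<lambda>a. a + a) ` H)"
proof -
  let ?D = "(\<lambda>a. a + a) ` H"
  have add: "x + y \<in> ?D" if xy: "x \<in> ?D" "y \<in> ?D" for x y
  proof -
    obtain x' y' where "x' \<in> H" "y' \<in> H" "x = x' + x'" "y = y' + y'" using xy by blast
    then show ?thesis using H
      by (intro image_eqI[of _ _ "x' + y'"]) (auto simp: additive_subgroup_of_def)
  qed
  have minus: "- x \<in> ?D" if x: "x \<in> ?D" for x
  proof -
    obtain x' where "x' \<in> H" "x = x' + x'" using x by blast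
    then show ?thesis using H
      by (intro image_eqI[of _ _ "- x'"]) (auto simp: additive_subgroup_of_def)
  qed
  have "b \<in> ?D" if "a \<in> ?D" "a + b \<in> ?D"
    using add[OF that(2) minus[OF that(1)]] by simp
  moreover have "a \<in> ?D" if "b \<in> ?D" "a + b \<in> ?D"
    using add[OF that(2) minus[OF that(1)]] by simp
  ultimately show ?thesis using add[of a b] rat_subgroup_odd_add[OF assms] by blast
qed

section \<open>Transport of classes along an isomorphism of the value group\<close>

lemma (in real_residue_valuation) value_group_eq: "value_group v = w ` (- {0})"
  by (auto simp: value_group_def v_w)

text \<open>Commutativity of values and the existence of halves are both pulled back from
  \<open>G\<close> through the bijection.\<close>

lemma (in real_residue_valuation) square_classes_of_group:
  fixes G :: "'k::ab_group_add set"
  assumes bij: "bij_betw \<phi> (value_group v) G"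
    and add: "\<And>a b. a \<in> value_group v \<Longrightarrow> b \<in> value_group v \<Longrightarrow> \<phi> (a + b) = \<phi> a + \<phi> b"
    and t1: "\<And>a b. a \<in> G \<Longrightarrow> b \<in> G \<Longrightarrow> t1 (a + b) \<longleftrightarrow> t1 a \<noteq> t1 b"
    and t2: "\<And>a b. a \<in> G \<Longrightarrow> b \<in> G \<Longrightarrow> t2 (a + b) \<longleftrightarrow> t2 a \<noteq> t2 b"
    and t: "\<And>a. a \<in> G \<Longrightarrow> \<not> t1 a \<Longrightarrow> \<not> t2 a \<Longrightarrow> \<exists>h\<in>G. a = h + h"
  shows "square_classes v (\<lambda>g. t1 (\<phi> g)) (\<lambda>g. t2 (\<phi> g))"
proof unfold_locales
  have in_group: "w a \<in> value_group v" if "a \<noteq> 0" for a using that by (auto simp: value_group_eq)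
  have in_G: "\<phi> (w a) \<in> G" if "a \<noteq> 0" for a using in_group[OF that] bij by (auto simp: bij_betw_def)
  have hom: "\<phi> (w a + w b) = \<phi> (w a) + \<phi> (w b)" if "a \<noteq> 0" "b \<noteq> 0" for a b
    using add in_group that by blast
  have in_group_add: "w a + w b \<in> value_group v" if "a \<noteq> 0" "b \<noteq> 0" for a b
    using in_group[of "a * b"] that by (simp add: w_mult)
  have inj: "x = y" if "x \<in> value_group v" "y \<in> value_group v" "\<phi> x = \<phi> y" for x y
    using bij that by (auto simp: bij_betw_def inj_on_def)
  fix a b :: 'd assume a: "a \<noteq> 0"
  show "\<exists>d. d \<noteq> 0 \<and> w a = w d + w d" if n: "\<not> t1 (\<phi> (w a))" "\<not> t2 (\<phi> (w a))"
  proof -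
    obtain h where h: "h \<in> G" "\<phi> (w a) = h + h" using t[OF in_G[OF a] n] by blast
    then obtain d where "d \<noteq> 0" "h = \<phi> (w d)"
      using bij by (auto simp: bij_betw_def value_group_eq)
    then show ?thesis using inj[OF in_group[OF a] in_group_add[of d d]] h hom[of d d] by auto
  qed
  assume b: "b \<noteq> 0"
  show "w a + w b = w b + w a"
    using inj[OF in_group_add[OF a b] in_group_add[OF b a]] hom a b by (simp add: add.commute)
  show "t1 (\<phi> (w a + w b)) \<longleftrightarrow> t1 (\<phi> (w a)) \<noteq> t1 (\<phi> (w b))"
    "t2 (\<phi> (w a + w b)) \<longleftrightarrow> t2 (\<phi> (w a)) \<noteq> t2 (\<phi> (w b))"
    using t1 t2 in_G a b by (simp_all add: hom)
qed

section \<open>The Weyl algebra inside its quotient division ring\<close>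

lemma weyl_pair_quotient:
  assumes "quotient_division_ring \<iota>"
  shows "weyl_pair (\<iota> weyl_x) (\<iota> weyl_y)"
proof
  have "weyl_y * weyl_x = weyl_x * weyl_y + 1"
    using weyl_commutator by (simp add: algebra_simps)
  then have "\<iota> (weyl_y * weyl_x) = \<iota> (weyl_x * weyl_y + 1)" by (rule arg_cong)
  then show "\<iota> weyl_y * \<iota> weyl_x - \<iota> weyl_x * \<iota> weyl_y = 1"
    using assms by (simp add: quotient_division_ring_def)
qed

text \<open>Induction on a representing term: the generators and constants have bounded degree, and
  the filtration absorbs sums and products.\<close>

lemma quotient_in_V:
  assumes \<iota>: "quotient_division_ring \<iota>"
  shows "\<exists>k. \<iota> a \<in> weyl_pair.V (\<iota> weyl_x) (\<iota> weyl_y) k"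
proof -
  interpret weyl_pair "\<iota> weyl_x" "\<iota> weyl_y" using \<iota> by (rule weyl_pair_quotient)
  have hom: "\<iota> (a + b) = \<iota> a + \<iota> b" "\<iota> (a * b) = \<iota> a * \<iota> b" "\<iota> (r *\<^sub>R a) = r *\<^sub>R \<iota> a" "\<iota> 1 = 1" for a b r
    using \<iota> by (simp_all add: quotient_division_ring_def)
  have "\<exists>k. \<iota> (abs_weyl t) \<in> V k" for t
  proof (induction t)
    case WX
    have "\<iota> weyl_x \<in> V (Suc 0)" using V_monomial[OF F_X, of 0] by simp
    then show ?case unfolding weyl_x.abs_eq by blast
  next
    case WY
    have "\<iota> weyl_y \<in> V (Suc 1)" using V_monomial[OF F_1, of 1] by simp
    then show ?case unfolding weyl_y.abs_eq by blast
  next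
    case (WConst r)
    \<comment> \<open>Scalar multiplication is defined as multiplication by \<open>WConst r\<close>,
      so this identifies the constant with a multiple of 1.\<close>
    have "weyl_eq (WConst r) (WMult (WConst r) (WConst 1))"
      by (rule weyl_eq.sym, rule weyl_eq.mult_one_right)
    then have "abs_weyl (WConst r) = r *\<^sub>R 1"
      by (simp add: one_weyl.abs_eq scaleR_weyl.abs_eq weyl.abs_eq_iff)
    then have "\<iota> (abs_weyl (WConst r)) = of_real r" by (simp add: hom of_real_def)
    then have "\<iota> (abs_weyl (WConst r)) \<in> V (Suc 0)" using V_monomial[OF F_of_real, of r 0] by simp
    then show ?case ..
  next
    case (WAdd s t)
    then obtain j k where "\<iota> (abs_weyl s) \<in> V j" "\<iota> (abs_weyl t) \<in> V k" by blast
    then have "\<iota> (abs_weyl s) + \<iota> (abs_weyl t) \<in> V (max j k)"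
      using V_mono[of j "max j k"] V_mono[of k "max j k"] by (intro V_add) auto
    then show ?case unfolding hom[symmetric] plus_weyl.abs_eq by blast
  next
    case (WMult s t)
    then obtain j k where "\<iota> (abs_weyl s) \<in> V j" "\<iota> (abs_weyl t) \<in> V k" by blast
    then have "\<iota> (abs_weyl s) * \<iota> (abs_weyl t) \<in> V (j + k)" by (rule V_mult)
    then show ?case unfolding hom[symmetric] times_weyl.abs_eq by blast
  qed
  then show ?thesis by (induct a rule: weyl.abs_induct) simp
qed

lemma commuting_square_classes_quotient:
  fixes \<iota> :: "weyl \<Rightarrow> 'd::real_div_algebra"
    and v :: "'d \<Rightarrow> 'g::totally_ordered_group with_infty"
  assumes \<iota>: "quotient_division_ring \<iota>" and "square_classes v c1 c2"
  shows "commuting_square_classes v c1 c2"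
proof -
  interpret square_classes v c1 c2 by fact
  interpret weyl_pair "\<iota> weyl_x" "\<iota> weyl_y" using \<iota> by (rule weyl_pair_quotient)
  interpret weyl_square_classes v c1 c2 "\<iota> weyl_x" "\<iota> weyl_y"
  proof
    fix d
    obtain a b where ab: "b \<noteq> 0" "d = \<iota> a * inverse (\<iota> b)"
      using \<iota> unfolding quotient_division_ring_def by metis
    obtain j k where jk: "\<iota> a \<in> V j" "\<iota> b \<in> V k" using quotient_in_V[OF \<iota>] by metis
    have "\<iota> 0 + \<iota> 0 = \<iota> (0 + 0)" "inj \<iota>" using \<iota> unfolding quotient_division_ring_def by metis+
    then have "\<iota> b \<noteq> 0" using ab(1) by (metis add.right_neutral add_left_cancel injD)
    moreover have "\<iota> a \<in> V (max j k)" "\<iota> b \<in> V (max j k)"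
      using jk V_mono[of j "max j k"] V_mono[of k "max j k"] by auto
    ultimately show "\<exists>p q k. p \<in> V k \<and> q \<in> V k \<and> q \<noteq> 0 \<and> d = p * inverse q"
      using ab(2) by blast
  qed
  show ?thesis using posunit_K by unfold_locales (simp add: K_def)
qed

theorem proposition6p1:
  fixes \<iota> :: "weyl \<Rightarrow> 'd::real_div_algebra"
    and v :: "'d \<Rightarrow> 'g::totally_ordered_group with_infty"
  assumes "quotient_division_ring \<iota>"
    and "valuation v"
    and "residue_field_real v"
  shows "((\<exists>H :: rat set. additive_subgroup_of H \<and> two_divisible H \<and>
              isomorphic_groups (value_group v) H)
            \<longrightarrow> (\<exists>!P. P \<in> compatible_orderings v)) \<and>
         ((\<exists>H :: rat set. additive_subgroup_of H \<and> \<not> two_divisible H \<and>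
              isomorphic_groups (value_group v) H)
            \<longrightarrow> card (compatible_orderings v) = 2) \<and>
         ((\<exists>H :: rat set. additive_subgroup_of H \<and> \<not> two_divisible H \<and>
              isomorphic_groups (value_group v) (H \<times> (UNIV :: int set)))
            \<longrightarrow> card (compatible_orderings v) = 4)"
proof -
  interpret real_residue_valuation v using assms(2,3) by unfold_locales
  let ?D = "\<lambda>H :: rat set. (\<lambda>a. a + a) ` H"
  \<comment> \<open>For a subgroup of the rationals one character suffices, so the second is
    constantly trivial.\<close>
  have rank_1: "commuting_square_classes v (\<lambda>g. \<phi> g \<notin> ?D H) (\<lambda>g. False)"
    if H: "additive_subgroup_of H" and bij: "bij_betw \<phi> (value_group v) H"
      and add: "\<forall>a\<in>value_group v. \<forall>b\<in>value_group v. \<phi> (a + b) = \<phi> a + \<phi> b" for \<phi> H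
    using square_classes_of_group[OF bij, of "\<lambda>a. a \<notin> ?D H" "\<lambda>a. False"] add
      rat_subgroup_class_add[OF H] by (intro commuting_square_classes_quotient[OF assms(1)]) blast
  have surj: "\<exists>a. a \<noteq> 0 \<and> \<phi> (w a) = h" if "bij_betw \<phi> (value_group v) G" "h \<in> G"
    for \<phi> :: "'g \<Rightarrow> 'k" and G h
    using that by (auto simp: bij_betw_def value_group_eq)
  have odd: "\<exists>h\<in>H. h \<notin> ?D H" if "additive_subgroup_of H" "\<not> two_divisible H" for H
  proof -
    have "?D H \<subseteq> H" using that(1) unfolding additive_subgroup_of_def by blast
    then show ?thesis using that(2) unfolding two_divisible_def by blast
  qed
  show ?thesis
  proof (intro conjI impI; elim exE conjE)
    fix H :: "rat set"
    assume H: "additive_subgroup_of H" "two_divisible H" "isomorphic_groups (value_group v) H"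
    then obtain \<phi> where \<phi>: "bij_betw \<phi> (value_group v) H"
      "\<forall>a\<in>value_group v. \<forall>b\<in>value_group v. \<phi> (a + b) = \<phi> a + \<phi> b"
      unfolding isomorphic_groups_def by blast
    interpret commuting_square_classes v "\<lambda>g. \<phi> g \<notin> ?D H" "\<lambda>g. False"
      using rank_1[OF H(1) \<phi>] .
    have "\<phi> (w a) \<in> ?D H" if "a \<noteq> 0" for a
      using that \<phi>(1) H(2) by (auto simp: two_divisible_def bij_betw_def value_group_eq)
    then show "\<exists>!P. P \<in> compatible_orderings v" using unique_ordering by blast
  next
    fix H :: "rat set"
    assume H: "additive_subgroup_of H" "\<not> two_divisible H" "isomorphic_groups (value_group v) H"
    then obtain \<phi> where \<phi>: "bij_betw \<phi> (value_group v) H"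
      "\<forall>a\<in>value_group v. \<forall>b\<in>value_group v. \<phi> (a + b) = \<phi> a + \<phi> b"
      unfolding isomorphic_groups_def by blast
    interpret commuting_square_classes v "\<lambda>g. \<phi> g \<notin> ?D H" "\<lambda>g. False"
      using rank_1[OF H(1) \<phi>] .
    obtain f where "f \<noteq> 0" "\<phi> (w f) \<notin> ?D H" using odd[OF H(1,2)] surj[OF \<phi>(1)] by metis
    then show "card (compatible_orderings v) = 2" using two_orderings by blast
  next
    fix H :: "rat set"
    assume H: "additive_subgroup_of H" "\<not> two_divisible H"
      "isomorphic_groups (value_group v) (H \<times> (UNIV :: int set))"
    then obtain \<phi> where \<phi>: "bij_betw \<phi> (value_group v) (H \<times> (UNIV :: int set))"
      "\<forall>a\<in>value_group v. \<forall>b\<in>value_group v. \<phi> (a + b) = \<phi> a + \<phi> b"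
      unfolding isomorphic_groups_def by blast
    \<comment> \<open>The two characters of the direct sum: the class in \<open>H\<close> modulo
      doubles and the parity of the integer coordinate.\<close>
    let ?t1 = "\<lambda>a :: rat \<times> int. fst a \<notin> ?D H" and ?t2 = "\<lambda>a :: rat \<times> int. odd (snd a)"
    have "\<exists>h\<in>H \<times> (UNIV :: int set). a = h + h" if a: "\<not> ?t1 a" "\<not> ?t2 a" for a
    proof -
      obtain h k where hk: "h \<in> H" "fst a = h + h" "snd a = 2 * k" using a by (auto elim!: evenE)
      then show ?thesis by (intro bexI[of _ "(h, k)"]) (auto simp: prod_eq_iff)
    qed
    moreover have "?t1 (a + b) \<longleftrightarrow> ?t1 a \<noteq> ?t1 b" if "a \<in> H \<times> UNIV" "b \<in> H \<times> UNIV" for a b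
      using rat_subgroup_class_add[OF H(1), of "fst a" "fst b"] that
      by (simp only: fst_add mem_Times_iff)
    moreover have "?t2 (a + b) \<longleftrightarrow> ?t2 a \<noteq> ?t2 b" for a b by auto
    ultimately have "square_classes v (\<lambda>g. ?t1 (\<phi> g)) (\<lambda>g. ?t2 (\<phi> g))"
      using \<phi>(2) by (intro square_classes_of_group[OF \<phi>(1), of ?t1 ?t2]) blast+
    then interpret commuting_square_classes v "\<lambda>g. ?t1 (\<phi> g)" "\<lambda>g. ?t2 (\<phi> g)"
      by (rule commuting_square_classes_quotient[OF assms(1)])
    obtain h where h: "h \<in> H" "h \<notin> ?D H" using odd[OF H(1,2)] by blast
    have 0: "0 \<in> H" "0 \<in> ?D H" using H(1) by (force simp: additive_subgroup_of_def)+
    \<comment> \<open>\<open>f\<close> and \<open>g\<close> are each detected by exactly one of the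
      two characters.\<close>
    obtain f where f: "f \<noteq> 0" "\<phi> (w f) = (h, 0)" using surj[OF \<phi>(1), of "(h, 0)"] h(1) by auto
    obtain g where g: "g \<noteq> 0" "\<phi> (w g) = (0, 1)" using surj[OF \<phi>(1), of "(0, 1)"] 0 by auto
    show "card (compatible_orderings v) = 4"
      by (rule four_orderings[of f g]) (use f g h 0 in simp_all)
  qed
qed

end
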